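(* Let $a\in[0,\infty)$, $b\in\mathbb{R}$, $\sigma,\delta\in(0,\infty)$, $\alpha\in(1,2)$ and $y_0\in[0,\infty)$, and let $(Y_t)_{t\ge 0}$ be the unique non-negative strong solution of $$\mathrm{d}Y_t=(a-bY_t)\,\mathrm{d}t+\sigma\sqrt{Y_t}\,\mathrm{d}W_t+\delta\sqrt[\alpha]{Y_{t-}}\,\mathrm{d}L_t,\quad t\ge 0,\qquad Y_0=y_0.$$ If $a\in(0,\infty)$ or $y_0\in(0,\infty)$, then for each $T\in(0,\infty)$ there exists, $\mathbb{P}$-almost surely, a unique maximum likelihood estimator (MLE) $\widehat b_T$ of $b$, having the form $$\widehat b_T=-\frac{Y_T-y_0-aT-\delta\int_0^T\sqrt[\alpha]{Y_{u-}}\,\mathrm{d}L_u}{\int_0^TY_s\,\mathrm{d}s},$$ provided that $\int_0^TY_s\,\mathrm{d}s\in(0,\infty)$ (which holds $\mathbb{P}$-almost surely).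
   Context: On a filtered probability space $(\Omega,\mathcal{F},(\mathcal{F}_t)_{t\ge0},\mathbb{P})$ satisfying the usual conditions, $(W_t)_{t\ge 0}$ is a standard Wiener process and $(L_t)_{t\ge 0}$ is a spectrally positive strictly $\alpha$-stable Lévy process independent of $W$ with $$\mathbb{E}(e^{\mathrm{i}\theta L_1})=\exp\left\{\int_0^\infty(e^{\mathrm{i}\theta z}-1-\mathrm{i}\theta z)\,C_\alpha z^{-1-\alpha}\,\mathrm{d}z\right\},\quad\theta\in\mathbb{R},\qquad C_\alpha:=(\alpha\Gamma(-\alpha))^{-1}.$$ The parameters $a,\sigma,\delta,\alpha$ and $y_0$ are known and $b\in\mathbb{R}$ is the unknown parameter to be estimated. For a fixed reference parameter $\widetilde b\in\mathbb{R}$ and $\beta\in\mathbb{R}$, the log-likelihood function based on the observations $(Y_t)_{t\in[0,T]}$ is $$\Lambda_T(\beta,\widetilde b):=-\frac{\beta-\widetilde b}{\sigma^2}\left(Y_T-y_0-aT-\delta\int_0^T\sqrt[\alpha]{Y_{u-}}\,\mathrm{d}L_u\right)-\frac{\beta^2-\widetilde b^2}{2\sigma^2}\int_0^TY_u\,\mathrm{d}u,$$ and an MLE of $b$ based on $(Y_t)_{t\in[0,T]}$ is $\widehat b_T:=\arg\max_{\beta\in\mathbb{R}}\Lambda_T(\beta,\widetilde b)$ (which turns out not to depend on $\widetilde b$). *)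

theory Defs
  imports "HOL-Probability.Probability"
begin

section \<open>Filtered probability spaces and processes\<close>

text \<open>
  Processes have type \<open>real \<Rightarrow> 'a \<Rightarrow> real\<close>, and only times \<open>t \<ge> 0\<close> matter. The library notion of a
  filtration is used with index type \<^typ>\<open>real\<close>; the members with negative index are irrelevant,
  since all stopping times below are non-negative.
\<close>

definition usual_conditions :: "'a measure \<Rightarrow> (real \<Rightarrow> 'a measure) \<Rightarrow> bool" where
  "usual_conditions M F \<longleftrightarrow>
     complete_measure M \<and> null_sets M \<subseteq> sets (F 0) \<and>
     (\<forall>t\<ge>0. sets (F t) = (\<Inter>s\<in>{t<..}. sets (F s)))"

definition filtered_prob_space :: "'a measure \<Rightarrow> (real \<Rightarrow> 'a measure) \<Rightarrow> bool" where
  "filtered_prob_space M F \<longleftrightarrow>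
     prob_space M \<and> filtration (space M) F \<and> (\<forall>t. subalgebra M (F t)) \<and> usual_conditions M F"

definition adapted :: "(real \<Rightarrow> 'a measure) \<Rightarrow> (real \<Rightarrow> 'a \<Rightarrow> real) \<Rightarrow> bool" where
  "adapted F X \<longleftrightarrow> (\<forall>t\<ge>0. X t \<in> borel_measurable (F t))"

definition cadlag :: "(real \<Rightarrow> real) \<Rightarrow> bool" where
  "cadlag f \<longleftrightarrow>
     (\<forall>t\<ge>0. (f \<longlongrightarrow> f t) (at_right t)) \<and> (\<forall>t>0. \<exists>l. (f \<longlongrightarrow> l) (at_left t))"

definition caglad :: "(real \<Rightarrow> real) \<Rightarrow> bool" where
  "caglad f \<longleftrightarrow>
     (\<forall>t>0. (f \<longlongrightarrow> f t) (at_left t)) \<and> (\<forall>t\<ge>0. \<exists>l. (f \<longlongrightarrow> l) (at_right t))"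

text \<open>\<open>X\<^sub>t\<^sub>-\<close>, with the usual convention \<open>X\<^sub>0\<^sub>- = X\<^sub>0\<close>.\<close>

definition left_limits :: "(real \<Rightarrow> 'a \<Rightarrow> real) \<Rightarrow> real \<Rightarrow> 'a \<Rightarrow> real" where
  "left_limits X t \<omega> = (if t \<le> 0 then X 0 \<omega> else Lim (at_left t) (\<lambda>s. X s \<omega>))"

section \<open>Wiener and stable Levy processes\<close>

definition increments_indep :: "'a measure \<Rightarrow> (real \<Rightarrow> 'a measure) \<Rightarrow> (real \<Rightarrow> 'a \<Rightarrow> real) \<Rightarrow> bool" where
  "increments_indep M F X \<longleftrightarrow>
     (\<forall>s t. 0 \<le> s \<and> s \<le> t \<longrightarrow>
        prob_space.indep_set M (sets (F s))
          (sets (vimage_algebra (space M) (\<lambda>\<omega>. X t \<omega> - X s \<omega>) borel)))"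

definition wiener_process :: "'a measure \<Rightarrow> (real \<Rightarrow> 'a measure) \<Rightarrow> (real \<Rightarrow> 'a \<Rightarrow> real) \<Rightarrow> bool" where
  "wiener_process M F W \<longleftrightarrow>
     adapted F W \<and> (AE \<omega> in M. W 0 \<omega> = 0) \<and> increments_indep M F W \<and>
     (\<forall>s t. 0 \<le> s \<and> s < t \<longrightarrow>
        distributed M lborel (\<lambda>\<omega>. W t \<omega> - W s \<omega>) (normal_density 0 (sqrt (t - s)))) \<and>
     (AE \<omega> in M. continuous_on {0..} (\<lambda>t. W t \<omega>))"

definition levy_process :: "'a measure \<Rightarrow> (real \<Rightarrow> 'a measure) \<Rightarrow> (real \<Rightarrow> 'a \<Rightarrow> real) \<Rightarrow> bool" where
  "levy_process M F X \<longleftrightarrow>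
     adapted F X \<and> (AE \<omega> in M. X 0 \<omega> = 0) \<and> increments_indep M F X \<and>
     (\<forall>s t. 0 \<le> s \<and> s \<le> t \<longrightarrow>
        distr M borel (\<lambda>\<omega>. X t \<omega> - X s \<omega>) = distr M borel (X (t - s))) \<and>
     (AE \<omega> in M. cadlag (\<lambda>t. X t \<omega>))"

definition spectrally_positive :: "'a measure \<Rightarrow> (real \<Rightarrow> 'a \<Rightarrow> real) \<Rightarrow> bool" where
  "spectrally_positive M X \<longleftrightarrow> (AE \<omega> in M. \<forall>t>0. left_limits X t \<omega> \<le> X t \<omega>)"

definition strictly_stable :: "'a measure \<Rightarrow> real \<Rightarrow> (real \<Rightarrow> 'a \<Rightarrow> real) \<Rightarrow> bool" where
  "strictly_stable M \<alpha> X \<longleftrightarrow>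
     (\<forall>c>0. \<forall>t\<ge>0. distr M borel (X (c * t)) = distr M borel (\<lambda>\<omega>. c powr (1 / \<alpha>) * X t \<omega>))"

definition stable_const :: "real \<Rightarrow> real" where
  "stable_const \<alpha> = inverse (\<alpha> * Gamma (- \<alpha>))"

definition stable_levy_process ::
  "'a measure \<Rightarrow> (real \<Rightarrow> 'a measure) \<Rightarrow> real \<Rightarrow> (real \<Rightarrow> 'a \<Rightarrow> real) \<Rightarrow> bool" where
  "stable_levy_process M F \<alpha> L \<longleftrightarrow>
     levy_process M F L \<and> spectrally_positive M L \<and> strictly_stable M \<alpha> L \<and>
     (\<forall>\<theta>. char (distr M borel (L 1)) \<theta> =
        exp (CLINT z:{0<..}|lborel.
               (exp (\<i> * \<theta> * z) - 1 - \<i> * \<theta> * z) * (stable_const \<alpha> * z powr (- 1 - \<alpha>))))"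

definition indep_processes ::
  "'a measure \<Rightarrow> (real \<Rightarrow> 'a \<Rightarrow> real) \<Rightarrow> (real \<Rightarrow> 'a \<Rightarrow> real) \<Rightarrow> bool" where
  "indep_processes M X Y \<longleftrightarrow>
     prob_space.indep_var M
       (PiM {0..} (\<lambda>_. borel)) (\<lambda>\<omega>. \<lambda>t\<in>{0..}. X t \<omega>)
       (PiM {0..} (\<lambda>_. borel)) (\<lambda>\<omega>. \<lambda>t\<in>{0..}. Y t \<omega>)"

section \<open>Stochastic integrals\<close>

text \<open>
  A simple predictable process is
  \<open>H\<^sub>t = \<xi> 1{t = 0} + (\<Sum>i<n. \<xi>\<^sub>i 1{\<tau>\<^sub>i < t \<le> \<tau>\<^sub>i\<^sub>+\<^sub>1})\<close> with finite stopping times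
  \<open>0 \<le> \<tau>\<^sub>0 \<le> \<dots> \<le> \<tau>\<^sub>n\<close>, with \<open>\<xi>\<close> measurable at time \<open>0\<close> and \<open>\<xi>\<^sub>i\<close> measurable at time \<open>\<tau>\<^sub>i\<close>.
\<close>

record 'a simple_process =
  sp_init :: "'a \<Rightarrow> real"
  sp_len :: nat
  sp_time :: "nat \<Rightarrow> 'a \<Rightarrow> real"
  sp_val :: "nat \<Rightarrow> 'a \<Rightarrow> real"

definition simple_predictable ::
  "'a measure \<Rightarrow> (real \<Rightarrow> 'a measure) \<Rightarrow> 'a simple_process \<Rightarrow> bool" where
  "simple_predictable M F S \<longleftrightarrow>
     sp_init S \<in> borel_measurable (F 0) \<and>
     (\<forall>i\<le>sp_len S. stopping_time F (sp_time S i)) \<and>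
     (\<forall>\<omega>\<in>space M. 0 \<le> sp_time S 0 \<omega>) \<and>
     (\<forall>i<sp_len S. (\<forall>\<omega>\<in>space M. sp_time S i \<omega> \<le> sp_time S (Suc i) \<omega>) \<and>
        sp_val S i \<in> borel_measurable (filtration.pre_sigma (space M) F (sp_time S i)))"

definition simple_path :: "'a simple_process \<Rightarrow> real \<Rightarrow> 'a \<Rightarrow> real" where
  "simple_path S t \<omega> =
     (if t = 0 then sp_init S \<omega> else 0) +
     (\<Sum>i<sp_len S. sp_val S i \<omega> * indicator {sp_time S i \<omega> <.. sp_time S (Suc i) \<omega>} t)"

definition simple_integral ::
  "(real \<Rightarrow> 'a \<Rightarrow> real) \<Rightarrow> 'a simple_process \<Rightarrow> real \<Rightarrow> 'a \<Rightarrow> real" where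
  "simple_integral X S t \<omega> =
     (\<Sum>i<sp_len S. sp_val S i \<omega> *
        (X (min t (sp_time S (Suc i) \<omega>)) \<omega> - X (min t (sp_time S i \<omega>)) \<omega>))"

text \<open>
  Convergence uniformly on compacts in probability. The event below is
  \<open>{sup\<^sub>0\<^sub>\<le>\<^sub>s\<^sub>\<le>\<^sub>t |X\<^sup>n\<^sub>s - X\<^sub>s| > \<epsilon>}\<close>. It is only used for adapted processes whose paths are almost
  surely one-sidedly continuous, so that it is measurable because \<open>M\<close> is complete.
\<close>

definition ucp_tendsto ::
  "'a measure \<Rightarrow> (nat \<Rightarrow> real \<Rightarrow> 'a \<Rightarrow> real) \<Rightarrow> (real \<Rightarrow> 'a \<Rightarrow> real) \<Rightarrow> bool" where
  "ucp_tendsto M Xn X \<longleftrightarrow>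
     (\<forall>t>0. \<forall>\<epsilon>>0.
        (\<lambda>n. measure M {\<omega> \<in> space M. \<exists>s\<in>{0..t}. \<epsilon> < \<bar>Xn n s \<omega> - X s \<omega>\<bar>}) \<longlonglongrightarrow> 0)"

text \<open>\<open>\<integral>\<^sub>0\<^sup>t (X\<^sup>n\<^sub>s - X\<^sub>s)\<^sup>2 ds \<rightarrow> 0\<close> in probability for every \<open>t\<close>.\<close>

definition L2_tendsto ::
  "'a measure \<Rightarrow> (nat \<Rightarrow> real \<Rightarrow> 'a \<Rightarrow> real) \<Rightarrow> (real \<Rightarrow> 'a \<Rightarrow> real) \<Rightarrow> bool" where
  "L2_tendsto M Xn X \<longleftrightarrow>
     (\<forall>t>0. \<forall>\<epsilon>>0.
        (\<lambda>n. measure M {\<omega> \<in> space M.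
           ennreal \<epsilon> < (\<integral>\<^sup>+s\<in>{0..t}. ennreal ((Xn n s \<omega> - X s \<omega>)\<^sup>2) \<partial>lborel)}) \<longlonglongrightarrow> 0)"

text \<open>
  \<open>I\<close> is (a version of) the stochastic integral process \<open>(\<integral>\<^sub>0\<^sup>t H dX)\<^sub>t\<close>: the value at \<open>H\<close> of the
  continuous extension of the elementary integral from the simple predictable processes, where
  integrands carry the mode of convergence \<open>conv\<close> and integral processes carry ucp convergence.
  The third conjunct says that \<open>H\<close> lies in the closure of the simple predictable processes, so
  that the fourth is not vacuous and determines \<open>I\<close> up to indistinguishability.
\<close>

definition integral_extension ::
  "'a measure \<Rightarrow> (real \<Rightarrow> 'a measure) \<Rightarrow>
   ((nat \<Rightarrow> real \<Rightarrow> 'a \<Rightarrow> real) \<Rightarrow> (real \<Rightarrow> 'a \<Rightarrow> real) \<Rightarrow> bool) \<Rightarrow>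
   (real \<Rightarrow> 'a \<Rightarrow> real) \<Rightarrow> (real \<Rightarrow> 'a \<Rightarrow> real) \<Rightarrow> (real \<Rightarrow> 'a \<Rightarrow> real) \<Rightarrow> bool" where
  "integral_extension M F conv X H I \<longleftrightarrow>
     adapted F I \<and> (AE \<omega> in M. cadlag (\<lambda>t. I t \<omega>)) \<and>
     (\<exists>S. (\<forall>n. simple_predictable M F (S n)) \<and> conv (\<lambda>n. simple_path (S n)) H) \<and>
     (\<forall>S. (\<forall>n. simple_predictable M F (S n)) \<and> conv (\<lambda>n. simple_path (S n)) H \<longrightarrow>
        ucp_tendsto M (\<lambda>n. simple_integral X (S n)) I)"

text \<open>The Ito integral of an adapted cadlag process with respect to a Wiener process.\<close>

definition ito_integral ::
  "'a measure \<Rightarrow> (real \<Rightarrow> 'a measure) \<Rightarrow>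
   (real \<Rightarrow> 'a \<Rightarrow> real) \<Rightarrow> (real \<Rightarrow> 'a \<Rightarrow> real) \<Rightarrow> (real \<Rightarrow> 'a \<Rightarrow> real) \<Rightarrow> bool" where
  "ito_integral M F W H I \<longleftrightarrow>
     adapted F H \<and> (AE \<omega> in M. cadlag (\<lambda>t. H t \<omega>)) \<and>
     integral_extension M F (L2_tendsto M) W H I"

text \<open>The integral of an adapted caglad process with respect to a semimartingale.\<close>

definition semimartingale_integral ::
  "'a measure \<Rightarrow> (real \<Rightarrow> 'a measure) \<Rightarrow>
   (real \<Rightarrow> 'a \<Rightarrow> real) \<Rightarrow> (real \<Rightarrow> 'a \<Rightarrow> real) \<Rightarrow> (real \<Rightarrow> 'a \<Rightarrow> real) \<Rightarrow> bool" where
  "semimartingale_integral M F X H I \<longleftrightarrow>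
     adapted F H \<and> (AE \<omega> in M. caglad (\<lambda>t. H t \<omega>)) \<and>
     integral_extension M F (ucp_tendsto M) X H I"

section \<open>The stable CIR process\<close>

text \<open>The filtration generated by \<open>W\<close> and \<open>L\<close>, augmented by the null sets.\<close>

definition augmented_filtration ::
  "'a measure \<Rightarrow> (real \<Rightarrow> 'a \<Rightarrow> real) \<Rightarrow> (real \<Rightarrow> 'a \<Rightarrow> real) \<Rightarrow> real \<Rightarrow> 'a measure" where
  "augmented_filtration M W L t =
     sigma (space M)
       ({W s -` B \<inter> space M | s B. s \<in> {0..t} \<and> B \<in> sets borel} \<union>
        {L s -` B \<inter> space M | s B. s \<in> {0..t} \<and> B \<in> sets borel} \<union> null_sets M)"

text \<open>The integrand \<open>(Y\<^sub>t\<^sub>-)\<^bsup>1/\<alpha>\<^esup>\<close> of the jump term.\<close>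

definition jump_coeff :: "real \<Rightarrow> (real \<Rightarrow> 'a \<Rightarrow> real) \<Rightarrow> real \<Rightarrow> 'a \<Rightarrow> real" where
  "jump_coeff \<alpha> Y t \<omega> = left_limits Y t \<omega> powr (1 / \<alpha>)"

definition stable_CIR_solution ::
  "'a measure \<Rightarrow> (real \<Rightarrow> 'a measure) \<Rightarrow> (real \<Rightarrow> 'a \<Rightarrow> real) \<Rightarrow> (real \<Rightarrow> 'a \<Rightarrow> real) \<Rightarrow>
   real \<Rightarrow> real \<Rightarrow> real \<Rightarrow> real \<Rightarrow> real \<Rightarrow> real \<Rightarrow> (real \<Rightarrow> 'a \<Rightarrow> real) \<Rightarrow> bool" where
  "stable_CIR_solution M F W L a b \<sigma> \<delta> \<alpha> y0 Y \<longleftrightarrow>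
     adapted F Y \<and> adapted (augmented_filtration M W L) Y \<and>
     (AE \<omega> in M. cadlag (\<lambda>t. Y t \<omega>)) \<and>
     (AE \<omega> in M. \<forall>t\<ge>0. 0 \<le> Y t \<omega>) \<and>
     (AE \<omega> in M. Y 0 \<omega> = y0) \<and>
     (\<exists>I J.
        ito_integral M F W (\<lambda>t \<omega>. sqrt (Y t \<omega>)) I \<and>
        semimartingale_integral M F L (jump_coeff \<alpha> Y) J \<and>
        (AE \<omega> in M. \<forall>t\<ge>0.
           Y t \<omega> = y0 + (LINT s:{0..t}|lborel. a - b * Y s \<omega>) + \<sigma> * I t \<omega> + \<delta> * J t \<omega>))"

section \<open>The likelihood function\<close>

text \<open>\<open>J\<close> stands for the stochastic integral process \<open>(\<integral>\<^sub>0\<^sup>t (Y\<^sub>u\<^sub>-)\<^bsup>1/\<alpha>\<^esup> dL\<^sub>u)\<^sub>t\<close>.\<close>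

definition log_likelihood ::
  "real \<Rightarrow> real \<Rightarrow> real \<Rightarrow> real \<Rightarrow> (real \<Rightarrow> 'a \<Rightarrow> real) \<Rightarrow> (real \<Rightarrow> 'a \<Rightarrow> real) \<Rightarrow>
   real \<Rightarrow> real \<Rightarrow> 'a \<Rightarrow> real \<Rightarrow> real" where
  "log_likelihood a \<sigma> \<delta> y0 Y J T b' \<omega> \<beta> =
     - ((\<beta> - b') / \<sigma>\<^sup>2) * (Y T \<omega> - y0 - a * T - \<delta> * J T \<omega>)
     - (\<beta>\<^sup>2 - b'\<^sup>2) / (2 * \<sigma>\<^sup>2) * (LINT u:{0..T}|lborel. Y u \<omega>)"

definition is_MLE ::
  "real \<Rightarrow> real \<Rightarrow> real \<Rightarrow> real \<Rightarrow> (real \<Rightarrow> 'a \<Rightarrow> real) \<Rightarrow> (real \<Rightarrow> 'a \<Rightarrow> real) \<Rightarrow>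
   real \<Rightarrow> real \<Rightarrow> 'a \<Rightarrow> real \<Rightarrow> bool" where
  "is_MLE a \<sigma> \<delta> y0 Y J T b' \<omega> \<beta> \<longleftrightarrow>
     is_arg_max (log_likelihood a \<sigma> \<delta> y0 Y J T b' \<omega>) (\<lambda>_. True) \<beta>"

text \<open>\<open>\<integral>\<^sub>0\<^sup>T Y\<^sub>s ds \<in> (0,\<infinity>)\<close>; integrability has to be stated, since the Bochner integral is total.\<close>

definition finite_positive_integral :: "(real \<Rightarrow> 'a \<Rightarrow> real) \<Rightarrow> real \<Rightarrow> 'a \<Rightarrow> bool" where
  "finite_positive_integral Y T \<omega> \<longleftrightarrow>
     set_integrable lborel {0..T} (\<lambda>s. Y s \<omega>) \<and> 0 < (LINT s:{0..T}|lborel. Y s \<omega>)"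

end

theory Submission
  imports Defs
begin

text \<open>
  For a fixed path the log-likelihood is a quadratic polynomial in \<open>\<beta>\<close> with leading coefficient
  \<open>- A / (2 \<sigma>\<^sup>2)\<close>, where \<open>A = \<integral>\<^sub>0\<^sup>T Y\<^sub>s ds\<close>. If \<open>A\<close> is positive, completing the square gives the
  maximizer and its uniqueness (\<open>is_MLE_iff\<close>). The probabilistic content is that \<open>A\<close> is almost
  surely finite and positive. Finiteness holds because cadlag paths are bounded on \<open>[0,T]\<close>. As \<open>Y\<close>
  is non-negative and right-continuous, \<open>A\<close> is positive as soon as \<open>Y\<close> is nonzero at some time
  before \<open>T\<close>, so it remains to show that the event \<open>Z\<close> that \<open>Y\<close> vanishes on all of \<open>[0,t]\<close> is null
  for \<open>t > 0\<close> (\<open>stable_CIR_not_zero_path\<close>).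

  On \<open>Z\<close> both integrands \<open>sqrt Y\<close> and \<open>Y\<^sub>-\<^bsup>1/\<alpha>\<^esup>\<close> vanish up to time \<open>t\<close>. Stochastic integrals
  are local: almost surely on \<open>Z\<close>, both integral processes vanish at \<open>t\<close> as well. The equation then
  reads \<open>0 = y\<^sub>0 + a t\<close>, while \<open>Y\<^sub>0 = 0\<close> forces \<open>y\<^sub>0 = 0\<close>; this is impossible if \<open>a\<close> or \<open>y\<^sub>0\<close>
  is positive.

  Locality comes from the freedom to choose the simple processes that approximate the integrand,
  since an integral is the limit along every such sequence. If all of their values vanish on \<open>Z\<close>
  before \<open>t\<close>, then so do their integrals at \<open>t\<close>, and the limit inherits this
  (\<open>ucp_limit_vanishes\<close>). For the Ito integral, the
  values of the integrand on a grid approximate it in \<open>L\<^sup>2\<close> of time, and on \<open>Z\<close> they are zero by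
  construction (\<open>ito_integral_vanishes\<close>). For the jump term a fixed grid does not converge
  uniformly, because the integrand jumps. Instead, given approximants within \<open>\<epsilon>\<close> of
  the integrand uniformly up to a small event, soft thresholding of their values at level \<open>\<epsilon>\<close>
  moves them by at most \<open>\<epsilon>\<close> and makes them vanish wherever the integrand is zero
  (\<open>semimartingale_integral_vanishes\<close>).
\<close>

section \<open>Cadlag paths\<close>

lemma cadlag_right: "cadlag f \<Longrightarrow> 0 \<le> t \<Longrightarrow> (f \<longlongrightarrow> f t) (at_right t)"
  by (simp add: cadlag_def)

lemma cadlag_if_continuous:
  assumes "continuous_on {0..} f"
  shows "cadlag f"
proof -
  have right: "(f \<longlongrightarrow> f t) (at_right t)" if "0 \<le> t" for t
  proof -
    have "(f \<longlongrightarrow> f t) (at t within {0..})"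
      using assms that by (auto simp: continuous_on_def)
    then show ?thesis
      by (rule tendsto_within_subset) (use that in auto)
  qed
  moreover have "(f \<longlongrightarrow> f t) (at_left t)" if "0 < t" for t
  proof -
    have "(f \<longlongrightarrow> f t) (at t within {0..})"
      using assms that by (auto simp: continuous_on_def)
    then have "(f \<longlongrightarrow> f t) (at t)"
      using that at_within_interior[of t "{0..}"] by simp
    then show ?thesis
      by (rule filterlim_mono) (auto simp: at_le)
  qed
  ultimately show ?thesis
    unfolding cadlag_def by blast
qed

text \<open>
  The one-sided limits bound the path near each point, and subdividing \<open>[0,t]\<close> turns
  this into a bound on the whole interval.
\<close>

lemma cadlag_bounded:
  assumes f: "cadlag f"
  obtains K where "\<And>s. s \<in> {0..t} \<Longrightarrow> \<bar>f s\<bar> \<le> K"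
proof (cases "0 \<le> t")
  case False
  then show ?thesis using that[of 0] by auto
next
  case True
  define P where "P u v \<longleftrightarrow> (\<exists>K. \<forall>s\<in>{u..v} \<inter> {0..}. \<bar>f s\<bar> \<le> K)" for u v
  have "P 0 t"
    using True
  proof (induction rule: Bolzano)
    case (trans a b c)
    then obtain K1 K2 where "\<forall>s\<in>{a..b} \<inter> {0..}. \<bar>f s\<bar> \<le> K1" "\<forall>s\<in>{b..c} \<inter> {0..}. \<bar>f s\<bar> \<le> K2"
      unfolding P_def by blast
    note K = this
    have "\<bar>f s\<bar> \<le> max K1 K2" if "s \<in> {a..c} \<inter> {0..}" for s
      using bspec[OF K(1), of s] bspec[OF K(2), of s] that by (cases "s \<le> b") auto
    then show ?case
      unfolding P_def by blast
  next
    case (local x)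
    have "\<forall>\<^sub>F s in at_right x. \<bar>f s\<bar> < \<bar>f x\<bar> + 1"
      using cadlag_right[OF f, of x] local
      by (intro order_tendstoD(2)[OF tendsto_rabs]) auto
    then obtain r where r: "x < r" "\<And>s. x < s \<Longrightarrow> s < r \<Longrightarrow> \<bar>f s\<bar> < \<bar>f x\<bar> + 1"
      unfolding eventually_at_right_field by blast
    have "\<exists>l K. l < x \<and> (\<forall>s. l < s \<and> s < x \<and> 0 \<le> s \<longrightarrow> \<bar>f s\<bar> < K)"
    proof (cases "x = 0")
      case True
      then show ?thesis by (intro exI[of _ "-1"] exI[of _ 0]) auto
    next
      case False
      with local(1) have "0 < x"
        by simp
      then obtain y where y: "(f \<longlongrightarrow> y) (at_left x)"
        using f unfolding cadlag_def by blast
      have "\<forall>\<^sub>F s in at_left x. \<bar>f s\<bar> < \<bar>y\<bar> + 1"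
        by (intro order_tendstoD(2)[OF tendsto_rabs[OF y]]) auto
      then show ?thesis
        unfolding eventually_at_left_field by blast
    qed
    then obtain l K where l: "l < x" "\<And>s. l < s \<Longrightarrow> s < x \<Longrightarrow> 0 \<le> s \<Longrightarrow> \<bar>f s\<bar> < K"
      by blast
    have "P u v" if "u \<le> x" "x \<le> v" "v - u < min (x - l) (r - x)" for u v
    proof -
      have "\<bar>f s\<bar> \<le> max K (\<bar>f x\<bar> + 1)" if s: "s \<in> {u..v} \<inter> {0..}" for s
      proof (cases s x rule: linorder_cases)
        case less
        then show ?thesis using l(2)[of s] s \<open>u \<le> x\<close> \<open>x \<le> v\<close> \<open>v - u < _\<close> by auto
      next
        case greater
        then show ?thesis using r(2)[of s] s \<open>u \<le> x\<close> \<open>x \<le> v\<close> \<open>v - u < _\<close> by auto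
      qed auto
      then show ?thesis
        unfolding P_def by blast
    qed
    moreover have "0 < min (x - l) (r - x)"
      using l(1) r(1) by simp
    ultimately show ?case
      by blast
  qed
  then obtain K where "\<forall>s\<in>{0..t} \<inter> {0..}. \<bar>f s\<bar> \<le> K"
    unfolding P_def by blast
  then show ?thesis
    by (intro that[of K]) auto
qed

text \<open>
  Jumps of size at least \<open>e\<close> are isolated: the left limit at \<open>y\<close> keeps the path within \<open>e\<close> of itself
  just before \<open>y\<close>, and right-continuity does the same just after \<open>y\<close>. Hence there are only
  countably many of them for each \<open>e = 1 / (n + 1)\<close>.
\<close>

lemma cadlag_countable_jumps:
  assumes f: "cadlag f"
  shows "countable {s. 0 < s \<and> \<not> (f \<longlongrightarrow> f s) (at_left s)}"
proof -
  define D where "D e = {s. 0 < s \<and> \<not> (\<forall>\<^sub>F x in at_left s. dist (f x) (f s) < e)}" for e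
  have "D e sparse_in {0<..}" if "0 < e" for e
    unfolding sparse_in_open[OF open_greaterThan]
  proof
    fix y :: real assume y: "y \<in> {0<..}"
    then obtain c where c: "(f \<longlongrightarrow> c) (at_left y)"
      using f unfolding cadlag_def by auto
    have "\<forall>\<^sub>F s in at_left y. dist (f s) c < e / 2" "\<forall>\<^sub>F s in at_right y. dist (f s) (f y) < e / 2"
      using tendstoD[OF c, of "e / 2"] tendstoD[OF cadlag_right[OF f, of y], of "e / 2"] that y
      by auto
    then obtain l r where l: "l < y" "\<And>s. l < s \<Longrightarrow> s < y \<Longrightarrow> dist (f s) c < e / 2"
      and r: "y < r" "\<And>s. y < s \<Longrightarrow> s < r \<Longrightarrow> dist (f s) (f y) < e / 2"
      unfolding eventually_at_left_field eventually_at_right_field by blast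
    have "s \<notin> D e" if s: "s \<in> {l<..<r}" "s \<noteq> y" for s
    proof (cases "s < y")
      case True
      have "dist (f x) (f s) < e" if "l < x" "x < s" for x
        using dist_triangle_half_l[of "f x" c e "f s"] l(2)[of x] l(2)[of s] that True s
        by (simp add: dist_commute)
      then have "\<forall>\<^sub>F x in at_left s. dist (f x) (f s) < e"
        unfolding eventually_at_left_field using s(1) by (intro exI[of _ l]) auto
      then show ?thesis by (simp add: D_def)
    next
      case False
      have "dist (f x) (f s) < e" if "y < x" "x < s" for x
        using dist_triangle_half_l[of "f x" "f y" e "f s"] r(2)[of x] r(2)[of s] that False s
        by (simp add: dist_commute)
      then have "\<forall>\<^sub>F x in at_left s. dist (f x) (f s) < e"
        unfolding eventually_at_left_field using s False by (intro exI[of _ y]) auto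
      then show ?thesis by (simp add: D_def)
    qed
    note no_jump = this
    show "\<not> y islimpt D e"
    proof
      assume "y islimpt D e"
      then obtain s where "s \<in> D e" "s \<in> {l<..<r}" "s \<noteq> y"
        using l(1) r(1) by (elim islimptE[where T = "{l<..<r}"]) auto
      with no_jump show False
        by blast
    qed
  qed
  then have "countable ({0<..} \<inter> D (1 / Suc n))" for n
    by (intro sparse_imp_countable) auto
  then have "countable (\<Union>n. {0<..} \<inter> D (1 / Suc n))"
    by blast
  moreover have "{s. 0 < s \<and> \<not> (f \<longlongrightarrow> f s) (at_left s)} \<subseteq> (\<Union>n. {0<..} \<inter> D (1 / Suc n))"
  proof
    fix s assume s: "s \<in> {s. 0 < s \<and> \<not> (f \<longlongrightarrow> f s) (at_left s)}"
    then obtain e where e: "0 < e" "\<not> (\<forall>\<^sub>F x in at_left s. dist (f x) (f s) < e)"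
      unfolding tendsto_iff by auto
    obtain n where n: "1 / Suc n < e"
      using nat_approx_posE[OF e(1)] by blast
    have "\<not> (\<forall>\<^sub>F x in at_left s. dist (f x) (f s) < 1 / Suc n)"
    proof
      assume "\<forall>\<^sub>F x in at_left s. dist (f x) (f s) < 1 / Suc n"
      then have "\<forall>\<^sub>F x in at_left s. dist (f x) (f s) < e"
        by eventually_elim (use n in linarith)
      with e(2) show False ..
    qed
    then show "s \<in> (\<Union>n. {0<..} \<inter> D (1 / Suc n))"
      using s by (auto simp: D_def)
  qed
  ultimately show ?thesis
    by (rule countable_subset[rotated])
qed

section \<open>Measurability through one-sided limits\<close>

text \<open>
  The random time is approximated strictly from the right by times with countably many values, where
  measurability is clear. If \<open>M\<close> is the time line and \<open>X s\<close> is constant for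
  each \<open>s\<close>, the lemma says that a right-continuous path is Borel measurable.
\<close>

lemma borel_measurable_at_random_time:
  fixes u :: "'a \<Rightarrow> real" and X :: "real \<Rightarrow> 'a \<Rightarrow> real"
  assumes u[measurable]: "u \<in> borel_measurable M" and u_nonneg: "\<And>x. x \<in> space M \<Longrightarrow> 0 \<le> u x"
    and X: "\<And>s. 0 \<le> s \<Longrightarrow> X s \<in> borel_measurable M"
    and right: "\<And>x. x \<in> space M \<Longrightarrow> ((\<lambda>s. X s x) \<longlongrightarrow> X (u x) x) (at_right (u x))"
  shows "(\<lambda>x. X (u x) x) \<in> borel_measurable M"
proof (rule borel_measurable_LIMSEQ_real)
  define v where "v n x = (real (nat \<lfloor>u x * Suc n\<rfloor>) + 1) / Suc n" for n x
  show "(\<lambda>x. X (v n x) x) \<in> borel_measurable M" for n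
  proof -
    have [measurable]: "X ((real k + 1) / Suc n) \<in> borel_measurable M" for k :: nat
      by (rule X) simp
    show ?thesis
      unfolding v_def
      by (rule measurable_compose_countable[where f = "\<lambda>k x. X ((real k + 1) / Suc n) x"]) measurable
  qed
  fix x assume x: "x \<in> space M"
  have v: "u x < v n x \<and> v n x \<le> u x + 1 / Suc n" for n
  proof -
    have "real (nat \<lfloor>u x * Suc n\<rfloor>) = of_int \<lfloor>u x * Suc n\<rfloor>"
      using u_nonneg[OF x] by (intro of_nat_nat) auto
    moreover have "u x * Suc n < of_int \<lfloor>u x * Suc n\<rfloor> + 1" "of_int \<lfloor>u x * Suc n\<rfloor> \<le> u x * Suc n"
      by linarith+
    ultimately show ?thesis
      by (simp add: v_def field_simps del: of_nat_Suc)
  qed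
  have "(\<lambda>n. u x + 1 / Suc n) \<longlonglongrightarrow> u x"
    using tendsto_add[OF tendsto_const LIMSEQ_inverse_real_of_nat, of "u x"]
    by (simp add: inverse_eq_divide)
  note upper = this
  have "(\<lambda>n. v n x) \<longlonglongrightarrow> u x"
  proof (rule tendsto_sandwich[OF _ _ tendsto_const upper])
    show "\<forall>\<^sub>F n in sequentially. u x \<le> v n x"
      using v by (intro always_eventually allI less_imp_le) blast
    show "\<forall>\<^sub>F n in sequentially. v n x \<le> u x + 1 / Suc n"
      using v by (intro always_eventually allI) blast
  qed
  then have "filterlim (\<lambda>n. v n x) (at_right (u x)) sequentially"
    using v by (intro filterlim_atI tendsto_imp_filterlim_at_right) auto
  then show "(\<lambda>n. X (v n x) x) \<longlonglongrightarrow> X (u x) x"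
    by (rule filterlim_compose[OF right[OF x]])
qed

text \<open>
  In a complete space the paths may be set to zero on the null set where they are irregular.
\<close>

lemma complete_borel_measurable_at_random_time:
  fixes u :: "'a \<Rightarrow> real" and X :: "real \<Rightarrow> 'a \<Rightarrow> real"
  assumes "complete_measure M"
    and u[measurable]: "u \<in> borel_measurable M" and u_nonneg: "\<And>x. x \<in> space M \<Longrightarrow> 0 \<le> u x"
    and X: "\<And>s. 0 \<le> s \<Longrightarrow> X s \<in> borel_measurable M"
    and cadlag: "AE x in M. cadlag (\<lambda>s. X s x)"
  shows "(\<lambda>x. X (u x) x) \<in> borel_measurable M"
proof -
  interpret complete_measure M by fact
  define N where "N = {x \<in> space M. \<not> cadlag (\<lambda>s. X s x)}"
  have N: "N \<in> null_sets M"
    using cadlag unfolding AE_iff_null_sets N_def .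
  then have [measurable]: "N \<in> sets M"
    by blast
  define X' where "X' s x = (if x \<in> N then 0 else X s x)" for s x
  have meas: "(\<lambda>x. X' (u x) x) \<in> borel_measurable M"
  proof (rule borel_measurable_at_random_time[where X = X' and u = u])
    show "X' s \<in> borel_measurable M" if "0 \<le> s" for s
      using X[OF that] unfolding X'_def by measurable
    show "((\<lambda>s. X' s x) \<longlongrightarrow> X' (u x) x) (at_right (u x))" if "x \<in> space M" for x
      using that u_nonneg[OF that] by (auto simp: X'_def N_def intro: cadlag_right)
  qed (use u_nonneg in auto)
  show ?thesis
  proof (rule measurableI)
    fix A :: "real set" assume A: "A \<in> sets borel"
    show "(\<lambda>x. X (u x) x) -` A \<inter> space M \<in> sets M"
    proof (rule in_sets_AE[OF _ measurable_sets[OF meas A]])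
      show "AE x in M. x \<in> (\<lambda>x. X' (u x) x) -` A \<inter> space M \<longleftrightarrow> x \<in> (\<lambda>x. X (u x) x) -` A \<inter> space M"
        using AE_not_in[OF N] by eventually_elim (auto simp: X'_def)
    qed auto
  qed auto
qed

text \<open>
  Almost sure one-sided continuity at every interior time reduces the existence of a time
  to a countable set, and completeness takes care of the exceptional null set. Without this
  measurability, convergence of the measures of such events would carry no information, since
  non-measurable sets have measure zero by convention.
\<close>

lemma sets_path_exceeds:
  fixes X :: "real \<Rightarrow> 'a \<Rightarrow> real"
  assumes "complete_measure M" and X: "\<And>s. 0 \<le> s \<Longrightarrow> X s \<in> borel_measurable M"
    and path: "AE x in M. \<forall>s>0. ((\<lambda>r. X r x) \<longlongrightarrow> X s x) (at_left s) \<or>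
       ((\<lambda>r. X r x) \<longlongrightarrow> X s x) (at_right s)"
  shows "{x \<in> space M. \<exists>s\<in>{0..t}. \<epsilon> < \<bar>X s x\<bar>} \<in> sets M"
proof -
  interpret complete_measure M by fact
  define D where "D = (\<rat> \<union> {0, t}) \<inter> {0..t}"
  have D: "countable D"
    unfolding D_def using countable_rat by auto
  show ?thesis
  proof (rule in_sets_AE)
    have "{x \<in> space M. \<exists>s\<in>D. \<epsilon> < \<bar>X s x\<bar>} = (\<Union>s\<in>D. {x \<in> space M. \<epsilon> < \<bar>X s x\<bar>})"
      by auto
    also have "\<dots> \<in> sets M"
    proof (rule sets.countable_UN''[OF D])
      fix s assume "s \<in> D"
      then have [measurable]: "X s \<in> borel_measurable M"
        by (intro X) (simp add: D_def)
      show "{x \<in> space M. \<epsilon> < \<bar>X s x\<bar>} \<in> sets M"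
        by measurable
    qed
    finally show "{x \<in> space M. \<exists>s\<in>D. \<epsilon> < \<bar>X s x\<bar>} \<in> sets M" .
    show "AE x in M. x \<in> {x \<in> space M. \<exists>s\<in>D. \<epsilon> < \<bar>X s x\<bar>} \<longleftrightarrow>
        x \<in> {x \<in> space M. \<exists>s\<in>{0..t}. \<epsilon> < \<bar>X s x\<bar>}"
      using path
    proof eventually_elim
      fix x
      assume lim: "\<forall>s>0. ((\<lambda>r. X r x) \<longlongrightarrow> X s x) (at_left s) \<or> ((\<lambda>r. X r x) \<longlongrightarrow> X s x) (at_right s)"
      have "\<exists>r\<in>D. \<epsilon> < \<bar>X r x\<bar>" if s: "s \<in> {0..t}" "\<epsilon> < \<bar>X s x\<bar>" for s
      proof (cases "s \<in> {0, t}")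
        case True
        then show ?thesis using s by (auto simp: D_def)
      next
        case False
        with s have st: "0 < s" "s < t" by auto
        from lim st(1) have "((\<lambda>r. X r x) \<longlongrightarrow> X s x) (at_left s) \<or> ((\<lambda>r. X r x) \<longlongrightarrow> X s x) (at_right s)"
          by blast
        then show ?thesis
        proof
          assume lim_s: "((\<lambda>r. X r x) \<longlongrightarrow> X s x) (at_left s)"
          have "\<forall>\<^sub>F r in at_left s. \<epsilon> < \<bar>X r x\<bar>"
            by (rule order_tendstoD(1)[OF tendsto_rabs[OF lim_s] s(2)])
          then obtain l where l: "l < s" "\<And>r. l < r \<Longrightarrow> r < s \<Longrightarrow> \<epsilon> < \<bar>X r x\<bar>"
            unfolding eventually_at_left_field by blast
          obtain q where "max l 0 < q" "q < s" "q \<in> \<rat>"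
            using Rats_dense_in_real[of "max l 0" s] l(1) st by auto
          then show ?thesis
            using l(2)[of q] st by (intro bexI[of _ q]) (auto simp: D_def)
        next
          assume lim_s: "((\<lambda>r. X r x) \<longlongrightarrow> X s x) (at_right s)"
          have "\<forall>\<^sub>F r in at_right s. \<epsilon> < \<bar>X r x\<bar>"
            by (rule order_tendstoD(1)[OF tendsto_rabs[OF lim_s] s(2)])
          then obtain u where u: "s < u" "\<And>r. s < r \<Longrightarrow> r < u \<Longrightarrow> \<epsilon> < \<bar>X r x\<bar>"
            unfolding eventually_at_right_field by blast
          obtain q where "s < q" "q < min u t" "q \<in> \<rat>"
            using Rats_dense_in_real[of s "min u t"] u(1) st by auto
          then show ?thesis
            using u(2)[of q] st by (intro bexI[of _ q]) (auto simp: D_def)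
        qed
      qed
      moreover have "D \<subseteq> {0..t}"
        by (auto simp: D_def)
      ultimately have "(\<exists>s\<in>D. \<epsilon> < \<bar>X s x\<bar>) \<longleftrightarrow> (\<exists>s\<in>{0..t}. \<epsilon> < \<bar>X s x\<bar>)"
        by (meson subsetD)
      then show "x \<in> {x \<in> space M. \<exists>s\<in>D. \<epsilon> < \<bar>X s x\<bar>} \<longleftrightarrow>
        x \<in> {x \<in> space M. \<exists>s\<in>{0..t}. \<epsilon> < \<bar>X s x\<bar>}"
        by (simp only: mem_Collect_eq)
    qed
  qed auto
qed

section \<open>Time integrals of cadlag paths\<close>

text \<open>
  A path on \<open>{0..}\<close> extended by its value at zero is right-continuous everywhere, hence Borel
  measurable.
\<close>

lemma cadlag_set_integrable:
  assumes f: "cadlag f"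
  shows "set_integrable lborel {0..t} f"
proof -
  obtain K where K: "\<And>s. s \<in> {0..t} \<Longrightarrow> \<bar>f s\<bar> \<le> K"
    using cadlag_bounded[OF f] by blast
  have [measurable]: "(\<lambda>s. f (max 0 s)) \<in> borel_measurable lborel"
    by (rule borel_measurable_at_random_time[where X = "\<lambda>s _. f s" and u = "max 0"])
      (auto intro!: cadlag_right[OF f])
  have "integrable lborel (\<lambda>s. indicator {0..t} s *\<^sub>R f (max 0 s))"
    by (rule integrableI_bounded_set_indicator[where B = K])
      (use K in \<open>auto simp: emeasure_lborel_Icc_eq max.absorb2\<close>)
  also have "(\<lambda>s. indicator {0..t} s *\<^sub>R f (max 0 s)) = (\<lambda>s. indicator {0..t} s *\<^sub>R f s)"
    by (auto simp: indicator_def)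
  finally show ?thesis
    by (simp add: set_integrable_def)
qed

lemma cadlag_integral_pos:
  assumes f: "cadlag f" and nonneg: "\<And>s. 0 \<le> s \<Longrightarrow> 0 \<le> f s" and s: "0 \<le> s" "s < t" "f s \<noteq> 0"
  shows "0 < (LINT s:{0..t}|lborel. f s)"
proof -
  have pos: "0 < f s / 2" "f s / 2 < f s"
    using nonneg[of s] s by auto
  obtain u where u: "s < u" "\<And>r. s < r \<Longrightarrow> r < u \<Longrightarrow> f s / 2 < f r"
    using order_tendstoD(1)[OF cadlag_right[OF f s(1)] pos(2)]
    unfolding eventually_at_right_field by blast
  define v where "v = min u t"
  have v: "s < v" "{s<..<v} \<subseteq> {0..t}"
    using u(1) s by (auto simp: v_def)
  have "0 < (f s / 2) * (v - s)"
    using pos v by simp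
  also have "\<dots> = (LINT r:{s<..<v}|lborel. f s / 2)"
    using v by (simp add: set_lebesgue_integral_def)
  also have "\<dots> \<le> (LINT r:{s<..<v}|lborel. f r)"
  proof (rule set_integral_mono)
    show "set_integrable lborel {s<..<v} f"
      by (rule set_integrable_subset[OF cadlag_set_integrable[OF f] _ v(2)]) simp
    show "set_integrable lborel {s<..<v} (\<lambda>r. f s / 2)"
      unfolding set_integrable_def using v(1) by simp
  qed (use u in \<open>auto simp: v_def intro: less_imp_le\<close>)
  also have "\<dots> \<le> (LINT r:{0..t}|lborel. f r)"
    unfolding set_lebesgue_integral_def
  proof (rule integral_mono)
    show "integrable lborel (\<lambda>r. indicator {s<..<v} r *\<^sub>R f r)"
      using set_integrable_subset[OF cadlag_set_integrable[OF f] _ v(2)]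
      by (simp add: set_integrable_def)
    show "integrable lborel (\<lambda>r. indicator {0..t} r *\<^sub>R f r)"
      using cadlag_set_integrable[OF f] by (simp add: set_integrable_def)
    show "indicator {s<..<v} r *\<^sub>R f r \<le> indicator {0..t} r *\<^sub>R f r" for r
      using v nonneg[of r] by (auto simp: indicator_def)
  qed
  finally show ?thesis .
qed

section \<open>Simple predictable processes\<close>

lemma filtered_prob_space_measurable:
  assumes "filtered_prob_space M F" "f \<in> borel_measurable (F t)"
  shows "f \<in> borel_measurable M"
  by (rule measurable_from_subalg[OF _ assms(2)]) (use assms(1) in \<open>simp add: filtered_prob_space_def\<close>)

lemma adapted_measurable:
  assumes "filtered_prob_space M F" "adapted F X" "0 \<le> t"
  shows "X t \<in> borel_measurable M"
  using assms filtered_prob_space_measurable unfolding adapted_def by blast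

lemma stopping_time_measurable:
  fixes \<tau> :: "'a \<Rightarrow> real"
  assumes "filtered_prob_space M F" "stopping_time F \<tau>"
  shows "\<tau> \<in> borel_measurable M"
  using assms by (intro measurable_stopping_time[of F])
    (auto simp: filtered_prob_space_def subalgebra_def)

text \<open>
  Stopping times are finite, so an event of \<open>F\<^sub>\<tau>\<close> is the union of its parts where \<open>\<tau> \<le> n\<close>, which
  belong to \<open>F\<^sub>n\<close>.
\<close>

lemma pre_sigma_measurable:
  fixes \<tau> :: "'a \<Rightarrow> real"
  assumes F: "filtered_prob_space M F" and \<tau>: "stopping_time F \<tau>"
    and f: "f \<in> borel_measurable (filtration.pre_sigma (space M) F \<tau>)"
  shows "f \<in> borel_measurable M"
proof -
  interpret filtration "space M" F
    using F by (simp add: filtered_prob_space_def)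
  have "sets (pre_sigma \<tau>) \<subseteq> sets M"
  proof
    fix A assume "A \<in> sets (pre_sigma \<tau>)"
    then have "{\<omega> \<in> A. \<tau> \<omega> \<le> real n} \<in> sets M" for n
      using F sets_pre_sigmaD[OF \<tau>, of A "real n"]
      by (auto simp: filtered_prob_space_def subalgebra_def)
    then have "(\<Union>n. {\<omega> \<in> A. \<tau> \<omega> \<le> real n}) \<in> sets M"
      by blast
    also have "(\<Union>n. {\<omega> \<in> A. \<tau> \<omega> \<le> real n}) = A"
    proof (intro equalityI subsetI)
      fix \<omega> assume "\<omega> \<in> A"
      moreover obtain n where "\<tau> \<omega> \<le> real n"
        using real_arch_simple by blast
      ultimately show "\<omega> \<in> (\<Union>n. {\<omega> \<in> A. \<tau> \<omega> \<le> real n})"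
        by blast
    qed blast
    finally show "A \<in> sets M" .
  qed
  then have "subalgebra M (pre_sigma \<tau>)"
    by (simp add: subalgebra_def space_pre_sigma)
  then show ?thesis
    by (rule measurable_from_subalg[OF _ f])
qed

lemma measurable_pre_sigma_const:
  fixes c :: real
  assumes F: "filtered_prob_space M F" and f: "f \<in> borel_measurable (F c)"
  shows "f \<in> borel_measurable (filtration.pre_sigma (space M) F (\<lambda>_. c))"
proof -
  interpret filtration "space M" F
    using F by (simp add: filtered_prob_space_def)
  have "sets (F c) \<subseteq> sets (pre_sigma (\<lambda>_. c))"
  proof
    fix A assume A: "A \<in> sets (F c)"
    have "{\<omega> \<in> A. c \<le> t} \<in> sets (F t)" for t
      using A sets_F_mono[of c t] by (cases "c \<le> t") auto
    then show "A \<in> sets (pre_sigma (\<lambda>_. c))"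
      by (rule sets_pre_sigmaI[OF stopping_time_const])
  qed
  then have "subalgebra (pre_sigma (\<lambda>_. c)) (F c)"
    by (simp add: subalgebra_def space_pre_sigma space_F)
  then show ?thesis
    by (rule measurable_from_subalg[OF _ f])
qed

lemma simple_predictable_times:
  assumes S: "simple_predictable M F S" and \<omega>: "\<omega> \<in> space M" and "i \<le> j" "j \<le> sp_len S"
  shows "0 \<le> sp_time S i \<omega>" "sp_time S i \<omega> \<le> sp_time S j \<omega>"
proof -
  have mono: "sp_time S k \<omega> \<le> sp_time S l \<omega>" if "k \<le> l" "l \<le> sp_len S" for k l
    using that
  proof (induction l rule: dec_induct)
    case (step m)
    then have "sp_time S k \<omega> \<le> sp_time S m \<omega>" by simp
    also have "\<dots> \<le> sp_time S (Suc m) \<omega>"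
      using S \<omega> step by (simp add: simple_predictable_def)
    finally show ?case .
  qed simp
  show "sp_time S i \<omega> \<le> sp_time S j \<omega>"
    by (rule mono) fact+
  have "0 \<le> sp_time S 0 \<omega>"
    using S \<omega> by (simp add: simple_predictable_def)
  also have "\<dots> \<le> sp_time S i \<omega>"
    using assms(3,4) by (intro mono) simp_all
  finally show "0 \<le> sp_time S i \<omega>" .
qed

text \<open>
  The intervals between consecutive times are disjoint and do not contain \<open>0\<close>, so at most one term
  of the sum is nonzero.
\<close>

lemma simple_path_active:
  assumes S: "simple_predictable M F S" and \<omega>: "\<omega> \<in> space M" and i: "i < sp_len S"
    and t: "sp_time S i \<omega> < t" "t \<le> sp_time S (Suc i) \<omega>"
  shows "simple_path S t \<omega> = sp_val S i \<omega>"
proof -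
  have "sp_val S j \<omega> * indicator {sp_time S j \<omega> <.. sp_time S (Suc j) \<omega>} t =
      (if j = i then sp_val S i \<omega> else 0)" if j: "j < sp_len S" for j
  proof (cases j i rule: linorder_cases)
    case less
    then show ?thesis
      using simple_predictable_times(2)[OF S \<omega>, of "Suc j" i] i t by (simp add: indicator_def)
  next
    case greater
    then show ?thesis
      using simple_predictable_times(2)[OF S \<omega>, of "Suc i" j] j t by (simp add: indicator_def)
  qed (use t in simp)
  then have "(\<Sum>j<sp_len S. sp_val S j \<omega> * indicator {sp_time S j \<omega> <.. sp_time S (Suc j) \<omega>} t) =
      (\<Sum>j<sp_len S. if j = i then sp_val S i \<omega> else 0)"
    by (intro sum.cong) auto
  moreover have "t \<noteq> 0"
    using simple_predictable_times(1)[OF S \<omega>, of i i] i t by simp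
  ultimately show ?thesis
    using i by (simp add: simple_path_def)
qed

lemma simple_path_inactive:
  assumes "\<And>i. i < sp_len S \<Longrightarrow> \<not> (sp_time S i \<omega> < t \<and> t \<le> sp_time S (Suc i) \<omega>)"
  shows "simple_path S t \<omega> = (if t = 0 then sp_init S \<omega> else 0)"
  using assms by (auto simp: simple_path_def indicator_def intro!: sum.neutral)

definition map_process :: "(real \<Rightarrow> real) \<Rightarrow> 'a simple_process \<Rightarrow> 'a simple_process" where
  "map_process f S = S\<lparr>sp_init := \<lambda>\<omega>. f (sp_init S \<omega>), sp_val := \<lambda>i \<omega>. f (sp_val S i \<omega>)\<rparr>"

lemma map_process_simps [simp]:
  "sp_init (map_process f S) \<omega> = f (sp_init S \<omega>)"
  "sp_len (map_process f S) = sp_len S"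
  "sp_time (map_process f S) = sp_time S"
  "sp_val (map_process f S) i \<omega> = f (sp_val S i \<omega>)"
  by (simp_all add: map_process_def)

lemma simple_predictable_map_process:
  assumes S: "simple_predictable M F S" and f: "f \<in> borel_measurable borel"
  shows "simple_predictable M F (map_process f S)"
  using S unfolding simple_predictable_def
  by (auto simp: map_process_def intro: measurable_compose[OF _ f])

lemma simple_path_map_process:
  assumes S: "simple_predictable M F S" and \<omega>: "\<omega> \<in> space M" 
    and f: "f \<in> borel_measurable borel" "f 0 = 0"
  shows "simple_path (map_process f S) t \<omega> = f (simple_path S t \<omega>)"
proof (cases "\<exists>i<sp_len S. sp_time S i \<omega> < t \<and> t \<le> sp_time S (Suc i) \<omega>")
  case True
  then obtain i where i: "i < sp_len S" "sp_time S i \<omega> < t" "t \<le> sp_time S (Suc i) \<omega>"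
    by blast
  have "simple_path (map_process f S) t \<omega> = sp_val (map_process f S) i \<omega>"
    using i by (intro simple_path_active[OF simple_predictable_map_process[OF S f(1)] \<omega>]) simp_all
  then show ?thesis
    using simple_path_active[OF S \<omega> i] by simp
next
  case False
  then have "simple_path (map_process f S) t \<omega> = (if t = 0 then f (sp_init S \<omega>) else 0)"
    by (subst simple_path_inactive) auto
  moreover have "simple_path S t \<omega> = (if t = 0 then sp_init S \<omega> else 0)"
    using False by (intro simple_path_inactive) auto
  ultimately show ?thesis
    using f by simp
qed

lemma simple_path_measurable:
  assumes F: "filtered_prob_space M F" and S: "simple_predictable M F S"
  shows "simple_path S t \<in> borel_measurable M"
proof -
  have times: "sp_time S i \<in> borel_measurable M" if "i \<le> sp_len S" for i
    using S that by (intro stopping_time_measurable[OF F]) (simp add: simple_predictable_def)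
  have vals: "sp_val S i \<in> borel_measurable M" if "i < sp_len S" for i
    using S that by (intro pre_sigma_measurable[OF F, of "sp_time S i"])
      (simp_all add: simple_predictable_def)
  have [measurable]: "sp_init S \<in> borel_measurable M"
    using S by (intro filtered_prob_space_measurable[OF F]) (auto simp: simple_predictable_def)
  have "(\<lambda>\<omega>. sp_val S i \<omega> * indicator {sp_time S i \<omega> <.. sp_time S (Suc i) \<omega>} t)
      \<in> borel_measurable M" if i: "i < sp_len S" for i
  proof -
    have [measurable]: "sp_time S i \<in> borel_measurable M" "sp_time S (Suc i) \<in> borel_measurable M"
        "sp_val S i \<in> borel_measurable M"
      using i times vals by auto
    show ?thesis
      unfolding indicator_def greaterThanAtMost_iff by measurable
  qed
  then have [measurable]: "(\<lambda>\<omega>. \<Sum>i<sp_len S. sp_val S i \<omega> *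
      indicator {sp_time S i \<omega> <.. sp_time S (Suc i) \<omega>} t) \<in> borel_measurable M"
    by (intro borel_measurable_sum) auto
  show ?thesis
    unfolding simple_path_def[abs_def] by measurable
qed

text \<open>
  A term with interval \<open>{u<..w}\<close> is constant on a left neighbourhood of every time, including \<open>w\<close>.
\<close>

lemma simple_path_left_continuous:
  assumes t: "0 < t"
  shows "((\<lambda>s. simple_path S s \<omega>) \<longlongrightarrow> simple_path S t \<omega>) (at_left t)"
proof -
  have init: "\<forall>\<^sub>F s in at_left t. (0::real) = (if s = 0 then sp_init S \<omega> else 0)"
    unfolding eventually_at_left_field using t by (intro exI[of _ 0]) auto
  have ind: "\<forall>\<^sub>F s in at_left t. indicator {u<..w} t = (indicator {u<..w} s :: real)" for u w
  proof (cases "t \<in> {u<..w}")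
    case True
    then show ?thesis
      unfolding eventually_at_left_field by (intro exI[of _ u]) auto
  next
    case False
    then show ?thesis
      unfolding eventually_at_left_field
      by (intro exI[of _ "if t \<le> u then t - 1 else w"]) (auto simp: indicator_def split: if_splits)
  qed
  have "((\<lambda>s. indicator {u<..w} s :: real) \<longlongrightarrow> indicator {u<..w} t) (at_left t)" for u w
    using tendsto_cong[OF ind, of u w] tendsto_const by blast
  moreover have "((\<lambda>s. if s = 0 then sp_init S \<omega> else 0) \<longlongrightarrow> 0) (at_left t)"
    using tendsto_cong[OF init] tendsto_const by blast
  ultimately have "((\<lambda>s. simple_path S s \<omega>) \<longlongrightarrow> 0 + (\<Sum>i<sp_len S. sp_val S i \<omega> *
      indicator {sp_time S i \<omega> <.. sp_time S (Suc i) \<omega>} t)) (at_left t)"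
    unfolding simple_path_def by (intro tendsto_add tendsto_sum tendsto_mult tendsto_const)
  then show ?thesis
    using t by (simp add: simple_path_def)
qed

text \<open>
  The stopped values \<open>X\<close> at \<open>min t \<tau>\<^sub>i\<close> are evaluations at random times, which is why the cadlag paths
  enter.
\<close>

lemma simple_integral_measurable:
  assumes F: "filtered_prob_space M F" and S: "simple_predictable M F S"
    and X: "adapted F X" "AE \<omega> in M. cadlag (\<lambda>t. X t \<omega>)" and t: "0 \<le> t"
  shows "simple_integral X S t \<in> borel_measurable M"
proof -
  have stopped: "(\<lambda>\<omega>. X (min t (sp_time S i \<omega>)) \<omega>) \<in> borel_measurable M" if "i \<le> sp_len S" for i
  proof (rule complete_borel_measurable_at_random_time[where X = X])
    show "complete_measure M"
      using F by (simp add: filtered_prob_space_def usual_conditions_def)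
    have [measurable]: "sp_time S i \<in> borel_measurable M"
      using S that by (intro stopping_time_measurable[OF F]) (simp add: simple_predictable_def)
    show "(\<lambda>\<omega>. min t (sp_time S i \<omega>)) \<in> borel_measurable M"
      by measurable
    show "0 \<le> min t (sp_time S i \<omega>)" if "\<omega> \<in> space M" for \<omega>
      using simple_predictable_times(1)[OF S that, of i i] \<open>i \<le> sp_len S\<close> t by simp
    show "X s \<in> borel_measurable M" if "0 \<le> s" for s
      by (rule adapted_measurable[OF F X(1) that])
  qed (rule X(2))
  have vals: "sp_val S i \<in> borel_measurable M" if "i < sp_len S" for i
    using S that by (intro pre_sigma_measurable[OF F, of "sp_time S i"])
      (simp_all add: simple_predictable_def)
  show ?thesis
    unfolding simple_integral_def[abs_def]
  proof (rule borel_measurable_sum)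
    fix i assume "i \<in> {..<sp_len S}"
    then have i: "i < sp_len S" "Suc i \<le> sp_len S" "i \<le> sp_len S"
      by auto
    show "(\<lambda>\<omega>. sp_val S i \<omega> * (X (min t (sp_time S (Suc i) \<omega>)) \<omega> - X (min t (sp_time S i \<omega>)) \<omega>))
        \<in> borel_measurable M"
      by (rule borel_measurable_times[OF vals[OF i(1)]
            borel_measurable_diff[OF stopped[OF i(2)] stopped[OF i(3)]]])
  qed
qed

lemma simple_integral_right_continuous:
  assumes S: "simple_predictable M F S" and \<omega>: "\<omega> \<in> space M"
    and X: "cadlag (\<lambda>t. X t \<omega>)" and t: "0 \<le> t"
  shows "((\<lambda>s. simple_integral X S s \<omega>) \<longlongrightarrow> simple_integral X S t \<omega>) (at_right t)"
proof -
  have "((\<lambda>s. X (min s u) \<omega>) \<longlongrightarrow> X (min t u) \<omega>) (at_right t)" if "0 \<le> u" for u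
  proof (cases "t < u")
    case True
    then have "\<forall>\<^sub>F s in at_right t. X s \<omega> = X (min s u) \<omega>"
      unfolding eventually_at_right_field by (intro exI[of _ u]) auto
    then show ?thesis
      using tendsto_cong[of "\<lambda>s. X s \<omega>"] cadlag_right[OF X t] True by auto
  next
    case False
    then have "\<forall>\<^sub>F s in at_right t. X u \<omega> = X (min s u) \<omega>"
      unfolding eventually_at_right_field by (intro exI[of _ "t + 1"]) auto
    then have "((\<lambda>s. X (min s u) \<omega>) \<longlongrightarrow> X u \<omega>) (at_right t)"
      by (rule Lim_transform_eventually[OF tendsto_const])
    then show ?thesis
      using False by (simp add: min_absorb2)
  qed
  note stopped = this
  show ?thesis
    unfolding simple_integral_def
    by (intro tendsto_sum tendsto_mult tendsto_diff tendsto_const stopped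
        simple_predictable_times(1)[OF S \<omega> order_refl]) auto
qed

lemma simple_integral_eq_zero:
  assumes S: "simple_predictable M F S" and \<omega>: "\<omega> \<in> space M"
    and zero: "\<And>i. i < sp_len S \<Longrightarrow> sp_time S i \<omega> < t \<Longrightarrow>
      sp_time S i \<omega> < sp_time S (Suc i) \<omega> \<Longrightarrow> sp_val S i \<omega> = 0"
  shows "simple_integral X S t \<omega> = 0"
  unfolding simple_integral_def
proof (rule sum.neutral, intro ballI)
  fix i assume i: "i \<in> {..<sp_len S}"
  then have "sp_time S i \<omega> \<le> sp_time S (Suc i) \<omega>"
    by (intro simple_predictable_times(2)[OF S \<omega>]) auto
  then consider "sp_val S i \<omega> = 0" | "t \<le> sp_time S i \<omega>" | "sp_time S i \<omega> = sp_time S (Suc i) \<omega>"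
    using zero[of i] i by force
  then show "sp_val S i \<omega> * (X (min t (sp_time S (Suc i) \<omega>)) \<omega> - X (min t (sp_time S i \<omega>)) \<omega>) = 0"
    by cases (use \<open>sp_time S i \<omega> \<le> _\<close> in \<open>auto simp: min_absorb1\<close>)
qed

section \<open>Locality of stochastic integrals\<close>

text \<open>
  The locality of stochastic integrals in the form used below. Outside of \<open>B\<^sub>n\<close>, a value
  \<open>|I\<^sub>t| > e\<close> on \<open>Z\<close> is an error of more than \<open>e\<close> in the approximation. So the probability of that
  event is at most \<open>P(error) + P(B\<^sub>n)\<close>, which tends to zero.
\<close>

lemma ucp_limit_vanishes:
  assumes F: "filtered_prob_space M F" and S: "\<And>n. simple_predictable M F (S n)"
    and X: "adapted F X" "AE \<omega> in M. cadlag (\<lambda>t. X t \<omega>)"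
    and I: "adapted F I" "AE \<omega> in M. cadlag (\<lambda>t. I t \<omega>)"
    and ucp: "ucp_tendsto M (\<lambda>n. simple_integral X (S n)) I"
    and B: "\<And>n. B n \<in> sets M" "(\<lambda>n. measure M (B n)) \<longlonglongrightarrow> 0"
    and Z: "Z \<in> sets M" and t: "0 < t"
    and zero: "\<And>n \<omega>. \<omega> \<in> Z - B n \<Longrightarrow> simple_integral X (S n) t \<omega> = 0"
  shows "AE \<omega> in M. \<omega> \<in> Z \<longrightarrow> I t \<omega> = 0"
proof -
  interpret prob_space M
    using F by (simp add: filtered_prob_space_def)
  note I_meas = adapted_measurable[OF F I(1)]
  have [measurable]: "I t \<in> borel_measurable M"
    using t by (intro I_meas) simp
  note [measurable] = Z
  have null: "{\<omega> \<in> space M. \<omega> \<in> Z \<and> e < \<bar>I t \<omega>\<bar>} \<in> null_sets M" if e: "0 < e" for e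
  proof -
    define E where "E n = {\<omega> \<in> space M. \<exists>s\<in>{0..t}. e < \<bar>simple_integral X (S n) s \<omega> - I s \<omega>\<bar>}" for n
    have E: "E n \<in> sets M" for n
      unfolding E_def
    proof (rule sets_path_exceeds)
      show "complete_measure M"
        using F by (simp add: filtered_prob_space_def usual_conditions_def)
      show "(\<lambda>\<omega>. simple_integral X (S n) s \<omega> - I s \<omega>) \<in> borel_measurable M" if "0 \<le> s" for s
        using simple_integral_measurable[OF F S X that] I_meas[OF that] by measurable
      show "AE \<omega> in M. \<forall>s>0.
          ((\<lambda>r. simple_integral X (S n) r \<omega> - I r \<omega>) \<longlongrightarrow> simple_integral X (S n) s \<omega> - I s \<omega>) (at_left s) \<or>
          ((\<lambda>r. simple_integral X (S n) r \<omega> - I r \<omega>) \<longlongrightarrow> simple_integral X (S n) s \<omega> - I s \<omega>) (at_right s)"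
        using X(2) I(2) AE_space
        by eventually_elim
          (intro allI impI disjI2 tendsto_diff simple_integral_right_continuous[OF S], auto intro: cadlag_right)
    qed
    have "(\<lambda>n. prob (E n) + prob (B n)) \<longlonglongrightarrow> 0 + 0"
      using ucp t e unfolding ucp_tendsto_def E_def by (intro tendsto_add B) auto
    moreover have "prob {\<omega> \<in> space M. \<omega> \<in> Z \<and> e < \<bar>I t \<omega>\<bar>} \<le> prob (E n) + prob (B n)" for n
    proof -
      have "{\<omega> \<in> space M. \<omega> \<in> Z \<and> e < \<bar>I t \<omega>\<bar>} \<subseteq> E n \<union> B n"
      proof
        fix \<omega> assume \<omega>: "\<omega> \<in> {\<omega> \<in> space M. \<omega> \<in> Z \<and> e < \<bar>I t \<omega>\<bar>}"
        show "\<omega> \<in> E n \<union> B n"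
        proof (cases "\<omega> \<in> B n")
          case False
          then have "e < \<bar>simple_integral X (S n) t \<omega> - I t \<omega>\<bar>"
            using zero[of \<omega> n] \<omega> by simp
          then show ?thesis
            using \<omega> t unfolding E_def by auto
        qed simp
      qed
      then have "prob {\<omega> \<in> space M. \<omega> \<in> Z \<and> e < \<bar>I t \<omega>\<bar>} \<le> prob (E n \<union> B n)"
        using E B by (intro finite_measure_mono) auto
      also have "\<dots> \<le> prob (E n) + prob (B n)"
        using E B by (intro measure_Un_le) auto
      finally show ?thesis .
    qed
    ultimately have "prob {\<omega> \<in> space M. \<omega> \<in> Z \<and> e < \<bar>I t \<omega>\<bar>} \<le> 0"
      by (intro LIMSEQ_le_const) auto
    then show ?thesis
      by (intro null_setsI) (simp_all add: emeasure_eq_measure measure_le_0_iff)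
  qed
  have "AE \<omega> in M. \<forall>n::nat. \<omega> \<notin> {\<omega> \<in> space M. \<omega> \<in> Z \<and> 1 / Suc n < \<bar>I t \<omega>\<bar>}"
    unfolding AE_all_countable by (intro allI AE_not_in null) simp
  with AE_space show ?thesis
  proof eventually_elim
    fix \<omega> assume "\<omega> \<in> space M" and *: "\<forall>n. \<omega> \<notin> {\<omega> \<in> space M. \<omega> \<in> Z \<and> 1 / Suc n < \<bar>I t \<omega>\<bar>}"
    show "\<omega> \<in> Z \<longrightarrow> I t \<omega> = 0"
    proof (rule impI, rule ccontr)
      assume "\<omega> \<in> Z" "I t \<omega> \<noteq> 0"
      then obtain n where "1 / Suc n < \<bar>I t \<omega>\<bar>"
        using nat_approx_posE[of "\<bar>I t \<omega>\<bar>"] by auto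
      with * \<open>\<omega> \<in> space M\<close> \<open>\<omega> \<in> Z\<close> show False by auto
    qed
  qed
qed

text \<open>
  Shrinks \<open>x\<close> towards zero by \<open>e\<close>, stopping at zero: the result is at distance at most \<open>e\<close> from \<open>x\<close>
  and vanishes on \<open>{-e..e}\<close>.
\<close>

definition soft_threshold :: "real \<Rightarrow> real \<Rightarrow> real" where
  "soft_threshold e x = x - max (- e) (min e x)"

lemma soft_threshold_eq_0: "\<bar>x\<bar> \<le> e \<Longrightarrow> soft_threshold e x = 0"
  by (auto simp: soft_threshold_def)

lemma soft_threshold_close: "0 \<le> e \<Longrightarrow> \<bar>soft_threshold e x - x\<bar> \<le> e"
  by (auto simp: soft_threshold_def)

lemma soft_threshold_measurable: "soft_threshold e \<in> borel_measurable borel"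
  unfolding soft_threshold_def[abs_def] by measurable

text \<open>
  Suitable approximants are within \<open>1 / (n + 1)\<close> of the integrand on \<open>[0, t + n]\<close>, except on
  an event \<open>B\<^sub>n\<close> of probability less than \<open>1 / (n + 1)\<close>. Soft thresholding at this level keeps the
  convergence, and on \<open>Z - B\<^sub>n\<close> all values that matter before \<open>t\<close> become zero.
\<close>

lemma semimartingale_integral_vanishes:
  assumes F: "filtered_prob_space M F"
    and X: "adapted F X" "AE \<omega> in M. cadlag (\<lambda>t. X t \<omega>)"
    and J: "semimartingale_integral M F X H J"
    and Z: "Z \<in> sets M" and t: "0 < t"
    and H0: "\<And>s \<omega>. \<omega> \<in> Z \<Longrightarrow> 0 \<le> s \<Longrightarrow> s \<le> t \<Longrightarrow> H s \<omega> = 0"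
  shows "AE \<omega> in M. \<omega> \<in> Z \<longrightarrow> J t \<omega> = 0"
proof -
  have H: "adapted F H" "AE \<omega> in M. caglad (\<lambda>t. H t \<omega>)"
    and ext: "integral_extension M F (ucp_tendsto M) X H J"
    using J by (auto simp: semimartingale_integral_def)
  obtain S where S: "\<And>n. simple_predictable M F (S n)"
    and conv: "ucp_tendsto M (\<lambda>n. simple_path (S n)) H"
    using ext unfolding integral_extension_def by blast
  define bad where "bad k u e =
    {\<omega> \<in> space M. \<exists>s\<in>{0..u}. e < \<bar>simple_path (S k) s \<omega> - H s \<omega>\<bar>}" for k u and e :: real
  have bad: "bad k u e \<in> sets M" for k u e
    unfolding bad_def
  proof (rule sets_path_exceeds)
    show "complete_measure M"
      using F by (simp add: filtered_prob_space_def usual_conditions_def)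
    show "(\<lambda>\<omega>. simple_path (S k) s \<omega> - H s \<omega>) \<in> borel_measurable M" if "0 \<le> s" for s
      using simple_path_measurable[OF F S] adapted_measurable[OF F H(1) that] by measurable
    show "AE \<omega> in M. \<forall>s>0.
        ((\<lambda>r. simple_path (S k) r \<omega> - H r \<omega>) \<longlongrightarrow> simple_path (S k) s \<omega> - H s \<omega>) (at_left s) \<or>
        ((\<lambda>r. simple_path (S k) r \<omega> - H r \<omega>) \<longlongrightarrow> simple_path (S k) s \<omega> - H s \<omega>) (at_right s)"
      using H(2)
      by eventually_elim
        (intro allI impI disjI1 tendsto_diff simple_path_left_continuous, auto simp: caglad_def)
  qed
  \<comment> \<open>The horizon \<open>t + n\<close> always covers \<open>[0,t]\<close> and eventually every compact interval.\<close>
  have "\<exists>k. measure M (bad k (t + real n) (1 / Suc n)) < 1 / Suc n" for n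
  proof -
    have "(\<lambda>k. measure M (bad k (t + real n) (1 / Suc n))) \<longlonglongrightarrow> 0"
      using conv t unfolding ucp_tendsto_def bad_def by simp
    then have "\<forall>\<^sub>F k in sequentially. measure M (bad k (t + real n) (1 / Suc n)) < 1 / Suc n"
      by (rule order_tendstoD(2)) simp
    then show ?thesis
      by (auto simp: eventually_sequentially)
  qed
  then obtain k where k: "\<And>n. measure M (bad (k n) (t + real n) (1 / Suc n)) < 1 / Suc n"
    by metis
  define B where "B n = bad (k n) (t + real n) (1 / Suc n)" for n
  define S' where "S' n = map_process (soft_threshold (1 / Suc n)) (S (k n))" for n
  have B: "B n \<in> sets M" for n
    by (simp add: B_def bad)
  have B_lim: "(\<lambda>n. measure M (B n)) \<longlonglongrightarrow> 0"
  proof (rule tendsto_sandwich[OF _ _ tendsto_const])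
    show "(\<lambda>n. 1 / real (Suc n)) \<longlonglongrightarrow> 0"
      using LIMSEQ_inverse_real_of_nat by (simp add: inverse_eq_divide)
    show "\<forall>\<^sub>F n in sequentially. 0 \<le> measure M (B n)"
      by simp
    show "\<forall>\<^sub>F n in sequentially. measure M (B n) \<le> 1 / real (Suc n)"
      unfolding B_def by (intro always_eventually allI less_imp_le k)
  qed
  have S': "simple_predictable M F (S' n)" for n
    unfolding S'_def by (rule simple_predictable_map_process[OF S soft_threshold_measurable])
  have path: "simple_path (S' n) s \<omega> = soft_threshold (1 / Suc n) (simple_path (S (k n)) s \<omega>)"
    if "\<omega> \<in> space M" for n s \<omega>
    unfolding S'_def using that
    by (intro simple_path_map_process[OF S _ soft_threshold_measurable]) (auto simp: soft_threshold_def)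
  have "ucp_tendsto M (\<lambda>n. simple_path (S' n)) H"
    unfolding ucp_tendsto_def
  proof (intro allI impI)
    fix u e :: real assume u: "0 < u" and e: "0 < e"
    have "\<forall>\<^sub>F n in sequentially. inverse (real (Suc n)) < e / 2"
      using order_tendstoD(2)[OF LIMSEQ_inverse_real_of_nat, of "e / 2"] e by simp
    moreover have "\<forall>\<^sub>F n in sequentially. u \<le> real n"
      by (rule eventually_sequentiallyI[of "nat \<lceil>u\<rceil>"]) linarith
    ultimately have "\<forall>\<^sub>F n in sequentially.
        measure M {\<omega> \<in> space M. \<exists>s\<in>{0..u}. e < \<bar>simple_path (S' n) s \<omega> - H s \<omega>\<bar>} \<le> measure M (B n)"
    proof eventually_elim
      case (elim n)
      interpret prob_space M
        using F by (simp add: filtered_prob_space_def)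
      show ?case
      proof (intro finite_measure_mono B subsetI)
        fix \<omega> assume "\<omega> \<in> {\<omega> \<in> space M. \<exists>s\<in>{0..u}. e < \<bar>simple_path (S' n) s \<omega> - H s \<omega>\<bar>}"
        then obtain s where s: "\<omega> \<in> space M" "s \<in> {0..u}" "e < \<bar>simple_path (S' n) s \<omega> - H s \<omega>\<bar>"
          by blast
        have "\<bar>simple_path (S' n) s \<omega> - simple_path (S (k n)) s \<omega>\<bar> \<le> 1 / Suc n"
          unfolding path[OF s(1)] by (rule soft_threshold_close) simp
        then have "1 / Suc n < \<bar>simple_path (S (k n)) s \<omega> - H s \<omega>\<bar>"
          using s(3) elim(1) unfolding inverse_eq_divide by linarith
        then show "\<omega> \<in> B n"
          using s(1,2) elim(2) t by (auto simp: B_def bad_def intro!: bexI[of _ s])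
      qed
    qed
    then show "(\<lambda>n. measure M {\<omega> \<in> space M. \<exists>s\<in>{0..u}. e < \<bar>simple_path (S' n) s \<omega> - H s \<omega>\<bar>})
        \<longlonglongrightarrow> 0"
      by (intro tendsto_sandwich[OF _ _ tendsto_const B_lim]) auto
  qed
  then have ucp: "ucp_tendsto M (\<lambda>n. simple_integral X (S' n)) J"
    using ext S' unfolding integral_extension_def by blast
  show ?thesis
  proof (rule ucp_limit_vanishes[OF F S' X _ _ ucp B B_lim Z t])
    fix n \<omega> assume \<omega>: "\<omega> \<in> Z - B n"
    then have sp: "\<omega> \<in> space M"
      using sets.sets_into_space[OF Z] by auto
    show "simple_integral X (S' n) t \<omega> = 0"
    proof (rule simple_integral_eq_zero[OF S' sp])
      fix i assume i: "i < sp_len (S' n)" "sp_time (S' n) i \<omega> < t"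
        "sp_time (S' n) i \<omega> < sp_time (S' n) (Suc i) \<omega>"
      \<comment> \<open>A time in \<open>[0,t]\<close> at which the \<open>i\<close>-th value is the value of the whole path.\<close>
      define s where "s = min t (sp_time (S (k n)) (Suc i) \<omega>)"
      have val: "simple_path (S (k n)) s \<omega> = sp_val (S (k n)) i \<omega>"
        using i by (intro simple_path_active[OF S sp]) (auto simp: S'_def s_def)
      have s: "0 \<le> s" "s \<le> t"
        using i t simple_predictable_times(1)[OF S' sp, of "Suc i" "Suc i" n]
        by (auto simp: S'_def s_def)
      have "\<bar>simple_path (S (k n)) s \<omega> - H s \<omega>\<bar> \<le> 1 / Suc n"
        using \<omega> sp s by (force simp: B_def bad_def not_less)
      then show "sp_val (S' n) i \<omega> = 0"
        using H0[of \<omega> s] s \<omega> by (simp add: S'_def val soft_threshold_eq_0)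
    qed
  qed (use ext in \<open>auto simp: integral_extension_def\<close>)
qed

text \<open>
  Step \<open>n\<close> samples \<open>H\<close> at mesh \<open>1 / (n + 1)\<close> up to time \<open>n + 1\<close>. The value at time zero does not
  affect an integral over time and is set to \<open>0\<close>.
\<close>

definition grid_process :: "(real \<Rightarrow> 'a \<Rightarrow> real) \<Rightarrow> nat \<Rightarrow> 'a simple_process" where
  "grid_process H n =
     \<lparr>sp_init = \<lambda>_. 0, sp_len = Suc n * Suc n, sp_time = \<lambda>i _. real i / Suc n,
      sp_val = \<lambda>i. H (real i / Suc n)\<rparr>"

lemma simple_predictable_grid_process:
  assumes F: "filtered_prob_space M F" and H: "adapted F H"
  shows "simple_predictable M F (grid_process H n)"
proof -
  have "H (real i / Suc n) \<in> borel_measurable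
      (filtration.pre_sigma (space M) F (\<lambda>_. real i / Suc n))" for i
    using H by (intro measurable_pre_sigma_const[OF F]) (simp add: adapted_def)
  then show ?thesis
    unfolding simple_predictable_def grid_process_def
    by (auto simp: stopping_time_const divide_right_mono)
qed

text \<open>
  The grid point that determines the value at \<open>s\<close> lies strictly before \<open>s\<close>, so only left limits
  matter.
\<close>

lemma grid_process_tendsto:
  assumes S: "\<And>n. simple_predictable M F (grid_process H n)" and \<omega>: "\<omega> \<in> space M"
    and s: "0 < s" and lim: "((\<lambda>r. H r \<omega>) \<longlongrightarrow> H s \<omega>) (at_left s)"
  shows "(\<lambda>n. simple_path (grid_process H n) s \<omega>) \<longlonglongrightarrow> H s \<omega>"
proof (rule tendstoI)
  fix e :: real assume "0 < e"
  then have "\<forall>\<^sub>F r in at_left s. dist (H r \<omega>) (H s \<omega>) < e"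
    by (rule tendstoD[OF lim])
  then obtain l where l: "l < s" "\<And>r. l < r \<Longrightarrow> r < s \<Longrightarrow> dist (H r \<omega>) (H s \<omega>) < e"
    unfolding eventually_at_left_field by blast
  have "\<forall>\<^sub>F n in sequentially. inverse (real (Suc n)) < s - l"
    using order_tendstoD(2)[OF LIMSEQ_inverse_real_of_nat, of "s - l"] l(1) by simp
  moreover have "\<forall>\<^sub>F n in sequentially. s \<le> real n"
    by (rule eventually_sequentiallyI[of "nat \<lceil>s\<rceil>"]) linarith
  ultimately show "\<forall>\<^sub>F n in sequentially. dist (simple_path (grid_process H n) s \<omega>) (H s \<omega>) < e"
  proof eventually_elim
    case (elim n)
    \<comment> \<open>The last grid point strictly before \<open>s\<close> has index \<open>\<lceil>s (n + 1)\<rceil> - 1\<close>.\<close>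
    define i where "i = nat (\<lceil>s * Suc n\<rceil> - 1)"
    have pos: "0 < s * Suc n"
      using s by simp
    then have i: "real i = of_int \<lceil>s * Suc n\<rceil> - 1"
      unfolding i_def by (subst of_nat_nat) auto
    have i': "real i < s * Suc n" "s * Suc n \<le> real i + 1"
      unfolding i by linarith+
    have "s * Suc n \<le> real n * Suc n"
      using elim(2) by (intro mult_right_mono) auto
    with i'(1) have "real i < real (n * Suc n)"
      by (simp only: of_nat_mult)
    then have len: "i < Suc n * Suc n"
      unfolding of_nat_less_iff by simp
    have times: "real i / Suc n < s" "s \<le> real (Suc i) / Suc n"
      using i' by (simp_all add: field_simps)
    have "simple_path (grid_process H n) s \<omega> = H (real i / Suc n) \<omega>"
      using simple_path_active[OF S \<omega>, of i n s] len times by (simp add: grid_process_def)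
    moreover have "l < real i / Suc n"
    proof -
      have "s - inverse (real (Suc n)) \<le> real i / Suc n"
        using times(2) by (simp add: add_divide_distrib inverse_eq_divide)
      then show ?thesis
        using elim(1) by linarith
    qed
    ultimately show ?case
      using l(2) times(1) by simp
  qed
qed

text \<open>
  Dominated convergence in time: the path and its samples are bounded by the same constant, and the
  samples converge except at time zero and at the countably many jumps.
\<close>

lemma grid_process_L2_tendsto:
  assumes S: "\<And>n. simple_predictable M F (grid_process H n)" and \<omega>: "\<omega> \<in> space M"
    and H: "cadlag (\<lambda>s. H s \<omega>)"
  shows "(\<lambda>n. \<integral>\<^sup>+s\<in>{0..t}. ennreal ((simple_path (grid_process H n) s \<omega> - H s \<omega>)\<^sup>2) \<partial>lborel) \<longlonglongrightarrow> 0"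
proof -
  obtain K where K: "\<And>s. s \<in> {0..t} \<Longrightarrow> \<bar>H s \<omega>\<bar> \<le> K"
    using cadlag_bounded[OF H] by blast
  have [measurable]: "(\<lambda>s. H (max 0 s) \<omega>) \<in> borel_measurable lborel"
    by (rule borel_measurable_at_random_time[where X = "\<lambda>s _. H s \<omega>" and u = "max 0"])
      (auto intro!: cadlag_right[OF H])
  have [measurable]: "(\<lambda>s. simple_path (grid_process H n) s \<omega>) \<in> borel_measurable lborel" for n
    unfolding simple_path_def by measurable
  have bound: "\<bar>simple_path (grid_process H n) s \<omega>\<bar> \<le> K" if s: "s \<in> {0..t}" for n s
  proof (cases "\<exists>i<sp_len (grid_process H n). sp_time (grid_process H n) i \<omega> < s \<and>
      s \<le> sp_time (grid_process H n) (Suc i) \<omega>")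
    case True
    then obtain i where "i < sp_len (grid_process H n)" "sp_time (grid_process H n) i \<omega> < s"
      "s \<le> sp_time (grid_process H n) (Suc i) \<omega>" by blast
    then show ?thesis
      using simple_path_active[OF S \<omega>, of i n s] K[of "real i / Suc n"] s
      by (auto simp: grid_process_def)
  next
    case False
    then have "simple_path (grid_process H n) s \<omega> = 0"
      by (subst simple_path_inactive) (auto simp: grid_process_def)
    then show ?thesis
      using K[OF s] by simp
  qed
  \<comment> \<open>\<open>max 0 s\<close> gives a Borel function on the whole line without changing the integral.\<close>
  define g where "g n s =
    ennreal ((simple_path (grid_process H n) s \<omega> - H (max 0 s) \<omega>)\<^sup>2) * indicator {0..t} s" for n s
  have [measurable]: "g n \<in> borel_measurable lborel" for n
    unfolding g_def[abs_def] by measurable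
  have "(\<lambda>n. \<integral>\<^sup>+s. g n s \<partial>lborel) \<longlonglongrightarrow> (\<integral>\<^sup>+s. 0 \<partial>(lborel :: real measure))"
  proof (rule nn_integral_dominated_convergence[where w = "\<lambda>s. ennreal ((2 * K)\<^sup>2) * indicator {0..t} s"])
    show "AE s in lborel. g n s \<le> ennreal ((2 * K)\<^sup>2) * indicator {0..t} s" for n
    proof (rule AE_I2)
      fix s
      show "g n s \<le> ennreal ((2 * K)\<^sup>2) * indicator {0..t} s"
      proof (cases "s \<in> {0..t}")
        case True
        then have "\<bar>simple_path (grid_process H n) s \<omega> - H (max 0 s) \<omega>\<bar> \<le> \<bar>2 * K\<bar>"
          using bound[OF True, of n] K[OF True] by (auto simp: max_def)
        then have "(simple_path (grid_process H n) s \<omega> - H (max 0 s) \<omega>)\<^sup>2 \<le> (2 * K)\<^sup>2"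
          by (simp only: abs_le_square_iff)
        then show ?thesis
          using True by (auto simp: g_def intro!: ennreal_leI)
      qed (simp add: g_def)
    qed
    show "(\<integral>\<^sup>+ s. ennreal ((2 * K)\<^sup>2) * indicator {0..t} s \<partial>lborel) < \<infinity>"
      by (subst nn_integral_cmult_indicator)
        (auto simp: emeasure_lborel_Icc_eq ennreal_mult_less_top)
    have "AE s in lborel. s \<notin> {0} \<union> {s. 0 < s \<and> \<not> ((\<lambda>r. H r \<omega>) \<longlongrightarrow> H s \<omega>) (at_left s)}"
      using cadlag_countable_jumps[OF H] by (intro AE_not_in countable_imp_null_set_lborel) auto
    then show "AE s in lborel. (\<lambda>n. g n s) \<longlonglongrightarrow> 0"
    proof eventually_elim
      case (elim s)
      show ?case
      proof (cases "s \<in> {0..t}")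
        case True
        then have "(\<lambda>n. simple_path (grid_process H n) s \<omega>) \<longlonglongrightarrow> H s \<omega>"
          using elim by (intro grid_process_tendsto[OF S \<omega>]) auto
        then have "(\<lambda>n. ennreal ((simple_path (grid_process H n) s \<omega> - H s \<omega>)\<^sup>2)) \<longlonglongrightarrow>
            ennreal ((H s \<omega> - H s \<omega>)\<^sup>2)"
          by (intro tendsto_intros)
        then show ?thesis
          using True by (simp add: g_def max.absorb2)
      qed (simp add: g_def)
    qed
  qed auto
  moreover have "(\<integral>\<^sup>+s. g n s \<partial>lborel) =
      (\<integral>\<^sup>+s\<in>{0..t}. ennreal ((simple_path (grid_process H n) s \<omega> - H s \<omega>)\<^sup>2) \<partial>lborel)" for n
    by (intro nn_integral_cong) (auto simp: g_def indicator_def max.absorb2)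
  ultimately show ?thesis
    by simp
qed

text \<open>
  The sets \<open>E n\<close> may be non-measurable; those that are have measure zero by convention, and
  dominated convergence applies to the others.
\<close>

lemma measure_tendsto_0_if_AE_eventually_notin:
  assumes "finite_measure M" and E: "AE \<omega> in M. \<forall>\<^sub>F n in sequentially. \<omega> \<notin> E n"
  shows "(\<lambda>n. measure M (E n)) \<longlonglongrightarrow> 0"
proof -
  interpret finite_measure M by fact
  define E' where "E' n = (if E n \<in> sets M then E n else {})" for n
  have E'_eq: "measure M (E n) = measure M (E' n)" for n
    by (simp add: E'_def measure_notin_sets)
  have [measurable]: "E' n \<in> sets M" for n
    by (simp add: E'_def)
  have "(\<lambda>n. \<integral>\<omega>. indicator (E' n) \<omega> \<partial>M) \<longlonglongrightarrow> (\<integral>\<omega>. (0::real) \<partial>M)"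
  proof (rule integral_dominated_convergence[where w = "\<lambda>_. 1"])
    show "AE \<omega> in M. (\<lambda>n. indicator (E' n) \<omega> :: real) \<longlonglongrightarrow> 0"
      using E
    proof eventually_elim
      case (elim \<omega>)
      then show ?case
        by (intro tendsto_eventually) (auto simp: E'_def elim: eventually_mono)
    qed
  qed (auto simp: indicator_def)
  then show ?thesis
    unfolding E'_eq by simp
qed

text \<open>
  On \<open>Z\<close> all grid values up to time \<open>t\<close> are zero, so the approximating integrals vanish at \<open>t\<close>
  without an exceptional event.
\<close>

lemma ito_integral_vanishes:
  assumes F: "filtered_prob_space M F"
    and X: "adapted F X" "AE \<omega> in M. cadlag (\<lambda>t. X t \<omega>)"
    and I: "ito_integral M F X H I"
    and Z: "Z \<in> sets M" and t: "0 < t"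
    and H0: "\<And>s \<omega>. \<omega> \<in> Z \<Longrightarrow> 0 \<le> s \<Longrightarrow> s \<le> t \<Longrightarrow> H s \<omega> = 0"
  shows "AE \<omega> in M. \<omega> \<in> Z \<longrightarrow> I t \<omega> = 0"
proof -
  have H: "adapted F H" "AE \<omega> in M. cadlag (\<lambda>t. H t \<omega>)"
    and ext: "integral_extension M F (L2_tendsto M) X H I"
    using I by (auto simp: ito_integral_def)
  have S: "simple_predictable M F (grid_process H n)" for n
    by (rule simple_predictable_grid_process[OF F H(1)])
  interpret prob_space M
    using F by (simp add: filtered_prob_space_def)
  have "L2_tendsto M (\<lambda>n. simple_path (grid_process H n)) H"
    unfolding L2_tendsto_def
  proof (intro allI impI measure_tendsto_0_if_AE_eventually_notin)
    fix u e :: real assume e: "0 < e"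
    show "AE \<omega> in M. \<forall>\<^sub>F n in sequentially. \<omega> \<notin> {\<omega> \<in> space M. ennreal e <
        (\<integral>\<^sup>+s\<in>{0..u}. ennreal ((simple_path (grid_process H n) s \<omega> - H s \<omega>)\<^sup>2) \<partial>lborel)}"
      using H(2) AE_space
    proof eventually_elim
      case (elim \<omega>)
      have "\<forall>\<^sub>F n in sequentially. (\<integral>\<^sup>+s\<in>{0..u}.
          ennreal ((simple_path (grid_process H n) s \<omega> - H s \<omega>)\<^sup>2) \<partial>lborel) < ennreal e"
        using grid_process_L2_tendsto[OF S elim(2,1)] by (rule order_tendstoD(2)) (use e in simp)
      then show ?case
        by eventually_elim auto
    qed
  qed unfold_locales
  then have ucp: "ucp_tendsto M (\<lambda>n. simple_integral X (grid_process H n)) I"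
    using ext S unfolding integral_extension_def by blast
  show ?thesis
  proof (rule ucp_limit_vanishes[where B = "\<lambda>_. {}", OF F S X _ _ ucp _ _ Z t])
    fix n \<omega> assume \<omega>: "\<omega> \<in> Z - {}"
    then have sp: "\<omega> \<in> space M"
      using sets.sets_into_space[OF Z] by auto
    show "simple_integral X (grid_process H n) t \<omega> = 0"
      using \<omega> by (intro simple_integral_eq_zero[OF S sp]) (auto simp: grid_process_def intro!: H0)
  qed (use ext in \<open>auto simp: integral_extension_def\<close>)
qed

section \<open>The stable CIR process does not stay at zero\<close>

text \<open>
  If \<open>Y\<close> vanishes on \<open>[0,t]\<close>, then the drift integral up to \<open>t\<close> is \<open>a t\<close> and both stochastic
  integrals vanish at \<open>t\<close>, which leaves \<open>y\<^sub>0 + a t = 0\<close> together with \<open>y\<^sub>0 = 0\<close>.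
\<close>

lemma stable_CIR_not_zero_path:
  assumes F: "filtered_prob_space M F" and W: "wiener_process M F W"
    and L: "levy_process M F L"
    and Y: "stable_CIR_solution M F W L a b \<sigma> \<delta> \<alpha> y0 Y"
    and start: "a \<noteq> 0 \<or> y0 \<noteq> 0" and t: "0 < t"
  shows "AE \<omega> in M. \<exists>s\<in>{0..t}. Y s \<omega> \<noteq> 0"
proof -
  have Y_adapted: "adapted F Y" and Y_cadlag: "AE \<omega> in M. cadlag (\<lambda>t. Y t \<omega>)"
    and Y0: "AE \<omega> in M. Y 0 \<omega> = y0"
    using Y by (auto simp: stable_CIR_solution_def)
  obtain I J where I: "ito_integral M F W (\<lambda>t \<omega>. sqrt (Y t \<omega>)) I"
    and J: "semimartingale_integral M F L (jump_coeff \<alpha> Y) J"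
    and eq: "AE \<omega> in M. \<forall>t\<ge>0. Y t \<omega> =
      y0 + (LINT s:{0..t}|lborel. a - b * Y s \<omega>) + \<sigma> * I t \<omega> + \<delta> * J t \<omega>"
    using Y unfolding stable_CIR_solution_def by blast
  define Z where "Z = space M - {\<omega> \<in> space M. \<exists>s\<in>{0..t}. 0 < \<bar>Y s \<omega>\<bar>}"
  have Z: "Z \<in> sets M"
    unfolding Z_def
  proof (intro sets.Diff sets.top sets_path_exceeds)
    show "complete_measure M"
      using F by (simp add: filtered_prob_space_def usual_conditions_def)
    show "Y s \<in> borel_measurable M" if "0 \<le> s" for s
      by (rule adapted_measurable[OF F Y_adapted that])
    show "AE \<omega> in M. \<forall>s>0. ((\<lambda>r. Y r \<omega>) \<longlongrightarrow> Y s \<omega>) (at_left s) \<or>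
        ((\<lambda>r. Y r \<omega>) \<longlongrightarrow> Y s \<omega>) (at_right s)"
      using Y_cadlag by eventually_elim (simp add: cadlag_def)
  qed
  have zero: "Y s \<omega> = 0" if "\<omega> \<in> Z" "0 \<le> s" "s \<le> t" for s \<omega>
    using that by (auto simp: Z_def)
  have "AE \<omega> in M. continuous_on {0..} (\<lambda>t. W t \<omega>)"
    using W by (simp add: wiener_process_def)
  then have W_cadlag: "AE \<omega> in M. cadlag (\<lambda>t. W t \<omega>)"
    by eventually_elim (rule cadlag_if_continuous)
  have I0: "AE \<omega> in M. \<omega> \<in> Z \<longrightarrow> I t \<omega> = 0"
    by (rule ito_integral_vanishes[OF F _ W_cadlag I Z t])
      (use W zero in \<open>simp_all add: wiener_process_def\<close>)
  have "jump_coeff \<alpha> Y s \<omega> = 0" if "\<omega> \<in> Z" "0 \<le> s" "s \<le> t" for s \<omega>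
  proof (cases "s = 0")
    case True
    then show ?thesis
      using zero[OF that(1), of 0] t by (simp add: jump_coeff_def left_limits_def)
  next
    case False
    with that have s: "0 < s"
      by simp
    have "\<forall>\<^sub>F r in at_left s. 0 = Y r \<omega>"
      unfolding eventually_at_left_field using s zero[OF that(1)] that(3) by (intro exI[of _ 0]) auto
    then have "((\<lambda>r. Y r \<omega>) \<longlongrightarrow> 0) (at_left s)"
      by (rule Lim_transform_eventually[OF tendsto_const])
    then have "Lim (at_left s) (\<lambda>r. Y r \<omega>) = 0"
      by (intro tendsto_Lim) auto
    then show ?thesis
      using s by (simp add: jump_coeff_def left_limits_def)
  qed
  then have J0: "AE \<omega> in M. \<omega> \<in> Z \<longrightarrow> J t \<omega> = 0"
    using L by (intro semimartingale_integral_vanishes[OF F _ _ J Z t]) (auto simp: levy_process_def)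
  from Y0 eq I0 J0 AE_space show ?thesis
  proof eventually_elim
    case (elim \<omega>)
    have "\<omega> \<notin> Z"
    proof
      assume \<omega>: "\<omega> \<in> Z"
      have "(LINT s:{0..t}|lborel. a - b * Y s \<omega>) = (LINT s:{0..t}|lborel. a)"
        using zero[OF \<omega>] by (intro set_lebesgue_integral_cong) auto
      also have "\<dots> = a * t"
        using t by (simp add: set_lebesgue_integral_def)
      finally have "Y t \<omega> = y0 + a * t"
        using elim(2-4) \<omega> t by simp
      moreover have "Y t \<omega> = 0" "y0 = 0"
        using zero[OF \<omega>, of t] zero[OF \<omega>, of 0] t elim(1) by auto
      ultimately show False
        using start t by simp
    qed
    then show ?case
      using elim(5) by (auto simp: Z_def)
  qed
qed

section \<open>The maximum likelihood estimator\<close>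

text \<open>
  With \<open>A\<close> the time integral of \<open>Y\<close>, the log-likelihood equals its value at \<open>m\<close> minus
  \<open>A / (2 \<sigma>\<^sup>2) (\<beta> - m)\<^sup>2\<close>, where \<open>m\<close> is the asserted maximizer. The reference parameter only
  changes it by a constant.
\<close>

lemma is_MLE_iff:
  assumes \<sigma>: "\<sigma> \<noteq> 0" and pos: "0 < (LINT s:{0..T}|lborel. Y s \<omega>)"
  shows "is_MLE a \<sigma> \<delta> y0 Y J T b' \<omega> bhat \<longleftrightarrow>
    bhat = - ((Y T \<omega> - y0 - a * T - \<delta> * J T \<omega>) / (LINT s:{0..T}|lborel. Y s \<omega>))"
proof -
  define A where "A = (LINT s:{0..T}|lborel. Y s \<omega>)"
  define N where "N = Y T \<omega> - y0 - a * T - \<delta> * J T \<omega>"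
  define m where "m = - (N / A)"
  define l where "l = log_likelihood a \<sigma> \<delta> y0 Y J T b' \<omega>"
  have A: "0 < A"
    using pos by (simp add: A_def)
  have N: "N = - (m * A)"
    using A by (simp add: m_def)
  have l: "l \<beta> = l m - A / (2 * \<sigma>\<^sup>2) * (\<beta> - m)\<^sup>2" for \<beta>
    using \<sigma> unfolding l_def log_likelihood_def A_def[symmetric] N_def[symmetric] N
    by (simp add: field_simps power2_eq_square)
  have "l m < l \<beta> \<longleftrightarrow> False" for \<beta>
    using A unfolding l[of \<beta>] by (simp add: not_less)
  moreover have "l \<beta> < l m" if "\<beta> \<noteq> m" for \<beta>
    using A \<sigma> that unfolding l[of \<beta>] by simp
  ultimately have "is_arg_max l (\<lambda>_. True) \<beta> \<longleftrightarrow> \<beta> = m" for \<beta>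
    unfolding is_arg_max_def by blast
  then show ?thesis
    by (simp add: is_MLE_def l_def m_def A_def N_def)
qed

theorem proposition4p2:
  fixes M :: "'w measure" and F :: "real \<Rightarrow> 'w measure"
    and W L Y J :: "real \<Rightarrow> 'w \<Rightarrow> real"
    and a b \<sigma> \<delta> \<alpha> y0 T :: real
  assumes "filtered_prob_space M F"
    and "wiener_process M F W"
    and "stable_levy_process M F \<alpha> L"
    and "indep_processes M W L"
    and "0 \<le> a" and "0 < \<sigma>" and "0 < \<delta>" and "1 < \<alpha>" and "\<alpha> < 2" and "0 \<le> y0"
    and "stable_CIR_solution M F W L a b \<sigma> \<delta> \<alpha> y0 Y"
    and "semimartingale_integral M F L (jump_coeff \<alpha> Y) J"
    and "0 < a \<or> 0 < y0"
    and "0 < T"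
  shows "(AE \<omega> in M. \<forall>b'. \<exists>!bhat. is_MLE a \<sigma> \<delta> y0 Y J T b' \<omega> bhat)
    \<and> (\<forall>\<omega>\<in>space M. finite_positive_integral Y T \<omega> \<longrightarrow>
         (\<forall>b' bhat. is_MLE a \<sigma> \<delta> y0 Y J T b' \<omega> bhat \<longleftrightarrow>
            bhat = - ((Y T \<omega> - y0 - a * T - \<delta> * J T \<omega>) / (LINT s:{0..T}|lborel. Y s \<omega>))))
    \<and> (AE \<omega> in M. finite_positive_integral Y T \<omega>)"
proof -
  have MLE: "is_MLE a \<sigma> \<delta> y0 Y J T b' \<omega> bhat \<longleftrightarrow>
      bhat = - ((Y T \<omega> - y0 - a * T - \<delta> * J T \<omega>) / (LINT s:{0..T}|lborel. Y s \<omega>))"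
    if "finite_positive_integral Y T \<omega>" for \<omega> b' bhat
    by (rule is_MLE_iff) (use that \<open>0 < \<sigma>\<close> in \<open>simp_all add: finite_positive_integral_def\<close>)
  have levy: "levy_process M F L"
    using assms(3) by (simp add: stable_levy_process_def)
  \<comment> \<open>The time \<open>T / 2\<close> leaves room to the right, so that \<open>Y\<close> stays positive on an interval inside \<open>[0,T]\<close>.\<close>
  have nonzero: "AE \<omega> in M. \<exists>s\<in>{0..T / 2}. Y s \<omega> \<noteq> 0"
    by (rule stable_CIR_not_zero_path[OF assms(1,2) levy assms(11)]) (use assms(13,14) in auto)
  have "AE \<omega> in M. cadlag (\<lambda>t. Y t \<omega>)" "AE \<omega> in M. \<forall>t\<ge>0. 0 \<le> Y t \<omega>"
    using assms(11) by (simp_all add: stable_CIR_solution_def)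
  then have pos: "AE \<omega> in M. finite_positive_integral Y T \<omega>"
    using nonzero
  proof eventually_elim
    case (elim \<omega>)
    obtain s where "s \<in> {0..T / 2}" "Y s \<omega> \<noteq> 0"
      using elim(3) by blast
    then have s: "0 \<le> s" "s < T" "Y s \<omega> \<noteq> 0"
      using assms(14) by simp_all
    have "0 < (LINT s:{0..T}|lborel. Y s \<omega>)"
      by (rule cadlag_integral_pos[OF elim(1) _ s]) (use elim(2) in blast)
    then show ?case
      using cadlag_set_integrable[OF elim(1)] unfolding finite_positive_integral_def by blast
  qed
  have "AE \<omega> in M. \<forall>b'. \<exists>!bhat. is_MLE a \<sigma> \<delta> y0 Y J T b' \<omega> bhat"
    using pos
  proof eventually_elim
    case (elim \<omega>)
    show ?case
      by (simp add: MLE[OF elim])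
  qed
  moreover have "\<forall>\<omega>\<in>space M. finite_positive_integral Y T \<omega> \<longrightarrow>
      (\<forall>b' bhat. is_MLE a \<sigma> \<delta> y0 Y J T b' \<omega> bhat \<longleftrightarrow>
        bhat = - ((Y T \<omega> - y0 - a * T - \<delta> * J T \<omega>) / (LINT s:{0..T}|lborel. Y s \<omega>)))"
    by (intro ballI impI allI MLE)
  ultimately show ?thesis
    using pos by (intro conjI)
qed

end
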